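(* Let $X_1,X_2,\dots$ be i.i.d. random variables whose distribution function is Pareto, $F(x)=1-x^{-\lambda}$ for $x\ge 1$, for some $\lambda>0$ (the null hypothesis $H_0$). Then, as $n\to\infty$, $$\sqrt n\, I_n^{(3)}\ \xrightarrow{d}\ \mathcal N\!\left(0,\tfrac{11}{120}\right).$$
   Context: For $n\ge 3$ and $t\ge 1$, let $$H_n(t)=\binom{n}{3}^{-1}\sum_{1\le i_1<i_2<i_3\le n}\mathbf 1\{X_{(3,\{i_1,i_2,i_3\})}/X_{(2,\{i_1,i_2,i_3\})}<t\},$$ where $X_{(s,\{i_1,i_2,i_3\})}$ is the $s$-th order statistic (in increasing order) of the subsample $X_{i_1},X_{i_2},X_{i_3}$. Let $F_n(t)=n^{-1}\sum_{i=1}^n\mathbf 1(X_i<t)$ be the empirical distribution function. The statistic is $$I_n^{(3)}=\int_1^\infty (H_n(t)-F_n(t))\,dF_n(t)=\frac1n\sum_{i=1}^n\bigl(H_n(X_i)-F_n(X_i)\bigr).$$ $\mathcal N(0,\sigma^2)$ denotes the normal law with mean $0$ and variance $\sigma^2$, and $\xrightarrow{d}$ denotes convergence in distribution. *)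

theory Defs
  imports "HOL-Probability.Probability"
begin

text \<open>
  A sample is a function \<open>x :: nat \<Rightarrow> real\<close> whose entries of interest are \<open>x 1, \<dots>, x n\<close>.
  Ranks \<open>s\<close> of order statistics start at \<open>1\<close>; ties are counted with multiplicity.
\<close>

definition order_stat :: "nat \<Rightarrow> nat set \<Rightarrow> (nat \<Rightarrow> real) \<Rightarrow> real" where
  "order_stat s A x = sort (map x (sorted_list_of_set A)) ! (s - 1)"

definition ratio_df :: "nat \<Rightarrow> (nat \<Rightarrow> real) \<Rightarrow> real \<Rightarrow> real" where
  "ratio_df n x t =
     inverse (real (n choose 3)) *
     (\<Sum>(i1, i2, i3) \<in> {(i1, i2, i3). 1 \<le> i1 \<and> i1 < i2 \<and> i2 < i3 \<and> i3 \<le> n}.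
        of_bool (order_stat 3 {i1, i2, i3} x / order_stat 2 {i1, i2, i3} x < t))"

text \<open>The empirical distribution function is taken left-continuous (strict inequality).\<close>

definition emp_df :: "nat \<Rightarrow> (nat \<Rightarrow> real) \<Rightarrow> real \<Rightarrow> real" where
  "emp_df n x t = inverse (real n) * (\<Sum>i = 1..n. of_bool (x i < t))"

text \<open>
  The Stieltjes measure of \<^const>\<open>emp_df\<close>, which puts mass \<open>1 / n\<close> at each of \<open>x 1, \<dots>, x n\<close>.
  The library's \<^const>\<open>interval_measure\<close> is not used because it expects a right-continuous
  function; lemma \<open>measure_emp_measure_lessThan\<close> below identifies the measure.
\<close>

definition emp_measure :: "nat \<Rightarrow> (nat \<Rightarrow> real) \<Rightarrow> real measure" where
  "emp_measure n x = distr (uniform_count_measure {1..n}) borel x"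

definition I3 :: "nat \<Rightarrow> (nat \<Rightarrow> real) \<Rightarrow> real" where
  "I3 n x = (LINT t:{1..}|emp_measure n x. ratio_df n x t - emp_df n x t)"

lemma borel_measurable_ratio_df [measurable]: "ratio_df n x \<in> borel_measurable borel"
  unfolding ratio_df_def[abs_def] case_prod_beta by measurable

lemma borel_measurable_emp_df [measurable]: "emp_df n x \<in> borel_measurable borel"
  unfolding emp_df_def[abs_def] by measurable

lemma integral_emp_measure:
  assumes "f \<in> borel_measurable borel" "n \<ge> 1"
  shows "integral\<^sup>L (emp_measure n x) f = inverse (real n) * (\<Sum>i = 1..n. f (x i) :: real)"
proof -
  have "integral\<^sup>L (emp_measure n x) f = (LINT i|uniform_count_measure {1..n}. f (x i))"
    unfolding emp_measure_def
    by (rule integral_distr) (use assms in \<open>auto simp: measurable_def space_uniform_count_measure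
        sets_uniform_count_measure\<close>)
  also have "\<dots> = inverse (real n) * (\<Sum>i = 1..n. f (x i))"
    using assms
    by (simp add: uniform_count_measure_def lebesgue_integral_point_measure_finite
        sum_distrib_left inverse_eq_divide sum_divide_distrib)
  finally show ?thesis .
qed

lemma measure_emp_measure_lessThan:
  assumes "n \<ge> 1"
  shows "measure (emp_measure n x) {..<t} = emp_df n x t"
proof -
  have "measure (emp_measure n x) {..<t} = integral\<^sup>L (emp_measure n x) (indicator {..<t})"
    by (simp add: emp_measure_def)
  also have "\<dots> = emp_df n x t"
    using assms by (subst integral_emp_measure) (auto simp: emp_df_def indicator_def)
  finally show ?thesis .
qed

lemma I3_eq_sum:
  assumes "n \<ge> 1" "\<And>i. 1 \<le> i \<Longrightarrow> i \<le> n \<Longrightarrow> x i \<ge> 1"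
  shows "I3 n x = inverse (real n) * (\<Sum>i = 1..n. ratio_df n x (x i) - emp_df n x (x i))"
proof -
  have "I3 n x = inverse (real n) *
      (\<Sum>i = 1..n. indicator {1..} (x i) *\<^sub>R (ratio_df n x (x i) - emp_df n x (x i)))"
    unfolding I3_def set_lebesgue_integral_def
    by (rule integral_emp_measure) (use assms in auto)
  also have "\<dots> = inverse (real n) * (\<Sum>i = 1..n. ratio_df n x (x i) - emp_df n x (x i))"
    using assms by (intro arg_cong2[where f = times] sum.cong) auto
  finally show ?thesis .
qed

end

theory Submission
  imports Defs "HOL-Real_Asymp.Real_Asymp"
begin

text \<open>
  Put \<open>U i = X i powr (- lam)\<close>. Under the null hypothesis the \<open>U i\<close> are independent and uniform on
  \<open>(0, 1)\<close>, and since \<open>x \<mapsto> x powr (- lam)\<close> is decreasing and multiplicative, the event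
  \<open>X a > X b > X c\<close> with \<open>X a / X b < X l\<close> is the event \<open>U a < U b < U c\<close> with \<open>U l * U b < U a\<close>.
  So, whatever \<open>lam\<close> is, the statistic is a functional of a uniform sample. Each unordered triple
  is strictly ordered in exactly one way when there are no ties, hence up to a normalisation error
  of order \<open>1 / n\<close> the statistic is the V-statistic of degree \<open>4\<close> with the bounded kernel
  \<open>6 * 1{y0 < y1 < y2, y3 * y1 < y0} - 1{y3 < y0}\<close> (lemma \<open>I3_close_to_vstatistic\<close>).

  A V-statistic with a bounded kernel is asymptotically normal by Hoeffding's decomposition. The
  kernel minus its mean and minus its one-variable projections is degenerate: it integrates to
  \<open>0\<close> as soon as all but one of its arguments are integrated out. Two values of a degenerate kernel
  at index tuples which share at most one index are therefore uncorrelated (lemma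
  \<open>expectation_degenerate_mult_eq_0\<close>), so of the \<open>n ^ (2 * m)\<close> covariances only the
  \<open>O(n ^ (2 * m - 2))\<close> ones with two coincidences survive, and the remainder is negligible at
  scale \<open>1 / sqrt n\<close> (lemma \<open>expectation_abs_vsum_le\<close>). What is left is
  the mean of the independent variables \<open>influence (U i)\<close>, to which the classical central limit
  theorem applies (theorem \<open>vstatistic_clt\<close>).

  For the kernel above the influence function is \<open>9/2 * t^2 - 4 * t - 1 - 6 * t * ln t\<close> on the
  unit interval: the projection on the fourth argument vanishes, because the top ratio of three
  Pareto variables is again Pareto distributed, and the other three projections are elementary
  integrals. Its second moment is \<open>11 / 120\<close> (lemma \<open>integral_pareto_influence_squared\<close>).
\<close>

section \<open>Convergence in distribution\<close>

lemma norm_iexp_diff_le: "cmod (iexp x - iexp y) \<le> \<bar>x - y\<bar>" for x y :: real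
proof -
  have "iexp x - iexp y = iexp y * (iexp (x - y) - 1)"
    by (simp add: algebra_simps flip: exp_add)
  then have "cmod (iexp x - iexp y) = cmod (iexp (x - y) - 1)"
    by (simp add: norm_mult)
  also have "\<dots> \<le> \<bar>x - y\<bar>"
    using iexp_approx1[of "x - y" 0] by simp
  finally show ?thesis .
qed

text \<open>
  A Slutsky lemma. Characteristic functions are \<open>\<bar>t\<bar>\<close>-Lipschitz in the random variable with
  respect to the \<open>L1\<close> distance, so a vanishing distance does not change the limit in
  Levy's continuity theorem.
\<close>

lemma (in prob_space) weak_conv_m_L1_close:
  fixes A B :: "nat \<Rightarrow> 'a \<Rightarrow> real"
  assumes [measurable]: "\<And>n. A n \<in> borel_measurable M" "\<And>n. B n \<in> borel_measurable M"
    and L: "real_distribution L"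
    and conv: "weak_conv_m (\<lambda>n. distr M borel (A n)) L"
    and int: "\<forall>\<^sub>F n in sequentially. integrable M (\<lambda>\<omega>. A n \<omega> - B n \<omega>)"
    and lim: "(\<lambda>n. expectation (\<lambda>\<omega>. \<bar>A n \<omega> - B n \<omega>\<bar>)) \<longlonglongrightarrow> 0"
  shows "weak_conv_m (\<lambda>n. distr M borel (B n)) L"
proof (rule levy_continuity)
  show "real_distribution (distr M borel (B n))" for n
    by (intro real_distribution_distr) simp
  show "real_distribution L" by fact
  fix t :: real
  have lA: "(\<lambda>n. char (distr M borel (A n)) t) \<longlonglongrightarrow> char L t"
    by (intro levy_continuity1 real_distribution_distr conv L) simp
  have bound: "cmod (char (distr M borel (B n)) t - char (distr M borel (A n)) t)
      \<le> \<bar>t\<bar> * expectation (\<lambda>\<omega>. \<bar>A n \<omega> - B n \<omega>\<bar>)"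
    if "integrable M (\<lambda>\<omega>. A n \<omega> - B n \<omega>)" for n
  proof -
    have i: "integrable M (\<lambda>\<omega>. iexp (t * A n \<omega>))" "integrable M (\<lambda>\<omega>. iexp (t * B n \<omega>))"
      by (intro integrable_const_bound[of _ 1] AE_I2; simp)+
    have "char (distr M borel (B n)) t - char (distr M borel (A n)) t
        = (CLINT \<omega>|M. iexp (t * B n \<omega>) - iexp (t * A n \<omega>))"
      using i by (simp add: char_def integral_distr)
    also have "cmod \<dots> \<le> expectation (\<lambda>\<omega>. cmod (iexp (t * B n \<omega>) - iexp (t * A n \<omega>)))"
      by (rule integral_norm_bound)
    also have "\<dots> \<le> expectation (\<lambda>\<omega>. \<bar>t\<bar> * \<bar>A n \<omega> - B n \<omega>\<bar>)"
    proof (rule integral_mono)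
      show "integrable M (\<lambda>\<omega>. cmod (iexp (t * B n \<omega>) - iexp (t * A n \<omega>)))"
        using i by auto
      show "integrable M (\<lambda>\<omega>. \<bar>t\<bar> * \<bar>A n \<omega> - B n \<omega>\<bar>)"
        using that by auto
      show "cmod (iexp (t * B n \<omega>) - iexp (t * A n \<omega>)) \<le> \<bar>t\<bar> * \<bar>A n \<omega> - B n \<omega>\<bar>" for \<omega>
        using norm_iexp_diff_le[of "t * B n \<omega>" "t * A n \<omega>"]
        by (simp add: abs_mult abs_minus_commute flip: right_diff_distrib)
    qed
    finally show ?thesis by simp
  qed
  have "(\<lambda>n. char (distr M borel (B n)) t - char (distr M borel (A n)) t) \<longlonglongrightarrow> 0"
    by (rule Lim_null_comparison[OF eventually_mono[OF int bound] tendsto_mult_right_zero[OF lim]])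
  from tendsto_add[OF this lA] show "(\<lambda>n. char (distr M borel (B n)) t) \<longlonglongrightarrow> char L t"
    by simp
qed

lemma weak_conv_m_scale:
  assumes M: "\<And>n. real_distribution (M n)" and L: "real_distribution L" and "weak_conv_m M L"
  shows "weak_conv_m (\<lambda>n. distr (M n) borel (\<lambda>x. c * x)) (distr L borel (\<lambda>x. c * x))"
proof -
  have dist: "real_distribution (distr K borel (\<lambda>x. c * x))" if "real_distribution K" for K
  proof -
    interpret real_distribution K by fact
    show ?thesis by (intro real_distribution_distr) simp
  qed
  have ch: "char (distr K borel (\<lambda>x. c * x)) t = char K (c * t)" if "real_distribution K" for K t
  proof -
    interpret real_distribution K by fact
    show ?thesis by (simp add: char_def integral_distr mult_ac)
  qed
  show ?thesis
    by (intro levy_continuity dist M L) (simp add: ch M L levy_continuity1 assms)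
qed

lemma distr_scale_std_normal:
  assumes "\<sigma> > 0"
  shows "distr std_normal_distribution borel (\<lambda>x. \<sigma> * x) = density lborel (normal_density 0 \<sigma>)"
proof -
  interpret prob_space std_normal_distribution
    by (rule prob_space_normal_density) simp
  have "distributed std_normal_distribution lborel (\<lambda>x. x) std_normal_density"
    by (auto simp: distributed_def distr_id2)
  from normal_density_affine[OF this, of \<sigma> 0] assms
  have "distributed std_normal_distribution lborel (\<lambda>x. \<sigma> * x) (normal_density 0 \<sigma>)"
    by simp
  then show ?thesis
    by (simp add: distributed_def cong: distr_cong)
qed

text \<open>
  The central limit theorem for i.i.d. centred variables, transported to a general variance and to sequences
  indexed from \<open>1\<close>.
\<close>

lemma (in prob_space) clt_from_one:
  fixes Y :: "nat \<Rightarrow> 'a \<Rightarrow> real"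
  assumes indep: "indep_vars (\<lambda>_. borel) Y {1..}"
    and law: "\<And>i. i \<ge> 1 \<Longrightarrow> distr M borel (Y i) = \<mu>"
    and mean: "integral\<^sup>L \<mu> (\<lambda>x. x) = 0"
    and sq: "integrable \<mu> (\<lambda>x. x\<^sup>2)" and var: "integral\<^sup>L \<mu> (\<lambda>x. x\<^sup>2) = \<sigma>\<^sup>2"
    and "\<sigma> > 0"
  shows "weak_conv_m (\<lambda>n. distr M borel (\<lambda>\<omega>. (\<Sum>i = 1..n. Y i \<omega>) / sqrt n))
           (density lborel (normal_density 0 \<sigma>))"
proof -
  have [measurable]: "Y (Suc i) \<in> borel_measurable M" for i
    using indep by (auto simp: indep_vars_def)
  have e: "expectation (\<lambda>x. f (Y (Suc i) x)) = integral\<^sup>L \<mu> f" if "f \<in> borel_measurable borel"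
    for i and f :: "real \<Rightarrow> real"
    unfolding law[of "Suc i", simplified, symmetric] by (subst integral_distr) (use that in auto)
  have S: "(\<Sum>i = 1..n. Y i \<omega>) = (\<Sum>i<n. Y (Suc i) \<omega>)" for n \<omega>
    by (rule sum.reindex_bij_witness[of _ Suc "\<lambda>i. i - 1"]) auto
  have "indep_vars (\<lambda>_. borel) (\<lambda>i. Y (Suc i)) UNIV"
    using indep_vars_compose2[OF indep_vars_restrict[OF indep, of UNIV "\<lambda>i. {Suc i}"],
        of "\<lambda>i f. f (Suc i)" "\<lambda>_. borel"]
    by (auto simp: disjoint_family_on_def)
  then have "weak_conv_m (\<lambda>n. distr M borel (\<lambda>x. (\<Sum>i<n. Y (Suc i) x) / sqrt (n * \<sigma>\<^sup>2)))
      std_normal_distribution"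
  proof (rule central_limit_theorem_zero_mean[where \<mu> = \<mu>])
    show "expectation (Y (Suc n)) = 0" for n
      using e[of "\<lambda>x. x"] mean by simp
    show "integrable M (\<lambda>x. (Y (Suc n) x)\<^sup>2)" for n
      using sq unfolding law[of "Suc n", simplified, symmetric] by (subst (asm) integrable_distr_eq) auto
    show "variance (Y (Suc n)) = \<sigma>\<^sup>2" for n
      using e[of "\<lambda>x. x"] e[of "\<lambda>x. x\<^sup>2"] mean var by simp
  qed (use law \<open>\<sigma> > 0\<close> in auto)
  then have "weak_conv_m
      (\<lambda>n. distr (distr M borel (\<lambda>x. (\<Sum>i<n. Y (Suc i) x) / sqrt (n * \<sigma>\<^sup>2))) borel (\<lambda>x. \<sigma> * x))
      (distr std_normal_distribution borel (\<lambda>x. \<sigma> * x))"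
    by (intro weak_conv_m_scale real_distribution_distr real_dist_normal_dist) auto
  moreover have "distr (distr M borel (\<lambda>x. (\<Sum>i<n. Y (Suc i) x) / sqrt (n * \<sigma>\<^sup>2))) borel (\<lambda>x. \<sigma> * x)
      = distr M borel (\<lambda>\<omega>. (\<Sum>i = 1..n. Y i \<omega>) / sqrt n)" for n
    unfolding S using \<open>\<sigma> > 0\<close> by (subst distr_distr) (auto simp: comp_def real_sqrt_mult)
  ultimately show ?thesis
    using \<open>\<sigma> > 0\<close> by (simp add: distr_scale_std_normal)
qed

section \<open>Counting index tuples\<close>

text \<open>
  A map with at most \<open>k\<close> values factors through \<open>{..<k}\<close>: it is one of \<open>k ^ L\<close> maps into
  \<open>{..<k}\<close> followed by one of \<open>card T ^ k\<close> maps into \<open>T\<close>. The set \<open>T\<close> must be nonempty because of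
  the empty map (\<open>L = 0\<close>).
\<close>

lemma card_PiE_range_le:
  fixes T :: "'b set" and n k L :: nat
  assumes "finite T" "T \<noteq> {}"
  shows "card {s \<in> {..<L} \<rightarrow>\<^sub>E T. card (s ` {..<L}) \<le> k} \<le> card T ^ k * k ^ L"
proof -
  let ?D = "({..<k} \<rightarrow>\<^sub>E T) \<times> ({..<L} \<rightarrow>\<^sub>E {..<k})"
  let ?f = "\<lambda>(e, c). \<lambda>i\<in>{..<L}. e (c i)"
  obtain t0 where t0: "t0 \<in> T" using assms by auto
  have fin: "finite ?D" using assms by (intro finite_cartesian_product finite_PiE) auto
  have "{s \<in> {..<L} \<rightarrow>\<^sub>E T. card (s ` {..<L}) \<le> k} \<subseteq> ?f ` ?D"
  proof (intro subsetI)
    fix s assume "s \<in> {s \<in> {..<L} \<rightarrow>\<^sub>E T. card (s ` {..<L}) \<le> k}"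
    then have s: "s \<in> {..<L} \<rightarrow>\<^sub>E T" and c: "card (s ` {..<L}) \<le> k" by auto
    have sT: "s ` {..<L} \<subseteq> T"
      by (rule image_subsetI) (rule PiE_mem[OF s])
    obtain g where g: "bij_betw g (s ` {..<L}) {..<card (s ` {..<L})}"
      using ex_bij_betw_finite_nat[of "s ` {..<L}"] by (auto simp: atLeast0LessThan)
    let ?e = "\<lambda>i\<in>{..<k}. if i < card (s ` {..<L}) then inv_into (s ` {..<L}) g i else t0"
    let ?c = "\<lambda>i\<in>{..<L}. g (s i)"
    have gs: "g (s i) < card (s ` {..<L})" if "i < L" for i
      using g that by (auto simp: bij_betw_def)
    have "s = ?f (?e, ?c)"
    proof
      fix i show "s i = ?f (?e, ?c) i"
      proof (cases "i < L")
        case True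
        then have eq: "inv_into (s ` {..<L}) g (g (s i)) = s i"
          using g by (intro inv_into_f_f) (auto simp: bij_betw_def)
        have "g (s i) < k" using gs[OF True] c by linarith
        then show ?thesis using True gs[OF True] eq by simp
      next
        case False then show ?thesis using PiE_arb[OF s, of i] by simp
      qed
    qed
    moreover have "?e \<in> {..<k} \<rightarrow>\<^sub>E T"
    proof -
      have "inv_into (s ` {..<L}) g i \<in> T" if "i < card (s ` {..<L})" for i
      proof -
        have "i \<in> g ` s ` {..<L}" using that bij_betw_imp_surj_on[OF g] by blast
        then have "inv_into (s ` {..<L}) g i \<in> s ` {..<L}" by (rule inv_into_into)
        then show ?thesis by (rule subsetD[OF sT])
      qed
      then show ?thesis using t0 unfolding restrict_PiE_iff by simp
    qed
    moreover have "?c \<in> {..<L} \<rightarrow>\<^sub>E {..<k}"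
      using gs c unfolding restrict_PiE_iff by (auto intro: less_le_trans)
    ultimately show "s \<in> ?f ` ?D" by (intro image_eqI[of _ _ "(?e, ?c)"]) (simp_all only: mem_Times_iff fst_conv snd_conv)
  qed
  then have "card {s \<in> {..<L} \<rightarrow>\<^sub>E T. card (s ` {..<L}) \<le> k} \<le> card ?D"
    using fin by (intro surj_card_le) auto
  also have "\<dots> = card T ^ k * k ^ L"
    by (simp add: card_cartesian_product card_PiE)
  finally show ?thesis .
qed

text \<open>
  Concatenate the two tuples and count the maps with few values.
\<close>

lemma card_overlapping_pairs_le:
  fixes T :: "'b set"
  assumes T: "finite T" "T \<noteq> {}"
  shows "card {(p, q) \<in> ({..<m} \<rightarrow>\<^sub>E T) \<times> ({..<m} \<rightarrow>\<^sub>E T). card (p ` {..<m} \<union> q ` {..<m}) \<le> l}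
    \<le> card T ^ l * l ^ (2 * m)" (is "card ?B \<le> _")
proof -
  let ?S = "{s \<in> {..<2 * m} \<rightarrow>\<^sub>E T. card (s ` {..<2 * m}) \<le> l}"
  let ?c = "\<lambda>(p, q). \<lambda>i\<in>{..<2 * m}. if i < m then p i else q (i - m)"
  have fin: "finite ({..<2 * m} \<rightarrow>\<^sub>E T)" using T by (intro finite_PiE) auto
  have "inj_on ?c ?B"
  proof (rule inj_onI)
    fix x y assume xy: "x \<in> ?B" "y \<in> ?B" and eq0: "?c x = ?c y"
    obtain p q p' q' where [simp]: "x = (p, q)" "y = (p', q')" by (metis surj_pair)
    have P: "p \<in> {..<m} \<rightarrow>\<^sub>E T" "q \<in> {..<m} \<rightarrow>\<^sub>E T" "p' \<in> {..<m} \<rightarrow>\<^sub>E T" "q' \<in> {..<m} \<rightarrow>\<^sub>E T"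
      using xy by simp_all
    have eq: "?c (p, q) = ?c (p', q')" using eq0 by simp
    have "p i = p' i" if "i < m" for i
      using fun_cong[OF eq, of i] that by simp
    moreover have "q i = q' i" if "i < m" for i
      using fun_cong[OF eq, of "i + m"] that by simp
    ultimately show "x = y"
      using PiE_ext[OF P(1,3)] PiE_ext[OF P(2,4)] by simp
  qed
  moreover have "?c ` ?B \<subseteq> ?S"
  proof (rule image_subsetI)
    fix x assume x: "x \<in> ?B"
    obtain p q where [simp]: "x = (p, q)" by (metis surj_pair)
    have P: "p \<in> {..<m} \<rightarrow>\<^sub>E T" "q \<in> {..<m} \<rightarrow>\<^sub>E T"
      and c: "card (p ` {..<m} \<union> q ` {..<m}) \<le> l"
      using x by simp_all
    have "?c (p, q) ` {..<2 * m} \<subseteq> p ` {..<m} \<union> q ` {..<m}"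
      by (auto split: if_splits)
    then have "card (?c (p, q) ` {..<2 * m}) \<le> l"
      by (intro order.trans[OF card_mono c]) auto
    moreover have "?c (p, q) \<in> {..<2 * m} \<rightarrow>\<^sub>E T"
      unfolding prod.case restrict_PiE_iff using PiE_mem[OF P(1)] PiE_mem[OF P(2)] by simp
    ultimately show "?c x \<in> ?S"
      unfolding \<open>x = (p, q)\<close> by (intro CollectI conjI)
  qed
  ultimately have "card ?B \<le> card ?S"
    using fin by (intro card_inj_on_le) auto
  also have "\<dots> \<le> card T ^ l * l ^ (2 * m)"
    by (rule card_PiE_range_le[OF T])
  finally show ?thesis .
qed

text \<open>
  If two injective tuples together take at least \<open>2 * card A - 1\<close> values, they share at most one
  value, and \<open>k\<close> is the position at which \<open>p\<close> takes it.
\<close>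

lemma nearly_disjoint_images:
  assumes A: "finite A" "A \<noteq> {}" and inj: "inj_on p A" "inj_on q A"
    and card: "\<not> card (p ` A \<union> q ` A) \<le> 2 * card A - 2"
  obtains k where "k \<in> A" "p ` (A - {k}) \<inter> q ` A = {}"
proof -
  have "card (p ` A \<union> q ` A) + card (p ` A \<inter> q ` A) = card A + card A"
    using card_Un_Int[of "p ` A" "q ` A"] A by (simp add: card_image inj)
  moreover have "card A > 0" using A by auto
  ultimately have "card (p ` A \<inter> q ` A) \<le> Suc 0"
    using card by linarith
  then have le1: "a = b" if "a \<in> p ` A \<inter> q ` A" "b \<in> p ` A \<inter> q ` A" for a b
    using that A card_le_Suc0_iff_eq[of "p ` A \<inter> q ` A"] by blast
  show ?thesis
  proof (cases "p ` A \<inter> q ` A = {}")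
    case True
    then show ?thesis using that A by blast
  next
    case False
    then obtain k where k: "k \<in> A" "p k \<in> q ` A" by blast
    have "p ` (A - {k}) \<inter> q ` A = {}"
    proof (rule ccontr)
      assume "p ` (A - {k}) \<inter> q ` A \<noteq> {}"
      then obtain j where j: "j \<in> A" "j \<noteq> k" "p j \<in> q ` A" by blast
      then have "p j = p k" using k by (intro le1) auto
      then show False using inj(1) k j by (auto simp: inj_on_def)
    qed
    then show ?thesis using that k by blast
  qed
qed

lemma sum_PiE_component:
  fixes f :: "'b \<Rightarrow> real"
  assumes "finite T" "k < m"
  shows "(\<Sum>p\<in>{..<m} \<rightarrow>\<^sub>E T. f (p k)) = real (card T) ^ (m - 1) * (\<Sum>i\<in>T. f i)"
proof -
  let ?f = "\<lambda>j i. if j = k then f i else 1"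
  have "(\<Sum>p\<in>{..<m} \<rightarrow>\<^sub>E T. f (p k)) = (\<Sum>p\<in>{..<m} \<rightarrow>\<^sub>E T. \<Prod>j<m. ?f j (p j))"
    using assms by (intro sum.cong refl) (simp add: prod.delta)
  also have "\<dots> = (\<Prod>j<m. \<Sum>i\<in>T. ?f j i)"
    using assms by (subst prod_sum_PiE) auto
  also have "\<dots> = (\<Sum>i\<in>T. f i) * (\<Prod>j\<in>{..<m} - {k}. \<Sum>i\<in>T. ?f j i)"
    using assms by (subst prod.remove[of _ k]) auto
  also have "(\<Prod>j\<in>{..<m} - {k}. \<Sum>i\<in>T. ?f j i) = (\<Prod>j\<in>{..<m} - {k}. real (card T))"
    by (intro prod.cong) auto
  finally show ?thesis using assms by (simp add: mult.commute)
qed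

section \<open>Orthogonality of degenerate kernels\<close>

lemma (in prob_space) distr_iid_reindex:
  assumes N: "prob_space N"
    and indep: "indep_vars (\<lambda>_. N) X I"
    and law: "\<And>i. i \<in> I \<Longrightarrow> distr M N (X i) = N"
    and inj: "inj_on p K" and sub: "p ` K \<subseteq> I"
  shows "distr M (PiM K (\<lambda>_. N)) (\<lambda>\<omega>. \<lambda>k\<in>K. X (p k) \<omega>) = PiM K (\<lambda>_. N)"
proof (cases "K = {}")
  case True
  interpret E: prob_space "PiM K (\<lambda>_. N)" by (intro prob_space_PiM N)
  have m: "(\<lambda>\<omega>. \<lambda>k\<in>K. X (p k) \<omega>) \<in> M \<rightarrow>\<^sub>M PiM K (\<lambda>_. N)"
    unfolding True by (rule measurable_restrict) simp
  interpret D: prob_space "distr M (PiM K (\<lambda>_. N)) (\<lambda>\<omega>. \<lambda>k\<in>K. X (p k) \<omega>)"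
    by (rule prob_space_distr[OF m])
  show ?thesis
  proof (rule measure_eqI)
    fix S assume "S \<in> sets (distr M (PiM K (\<lambda>_. N)) (\<lambda>\<omega>. \<lambda>k\<in>K. X (p k) \<omega>))"
    then have "S \<subseteq> space (PiM K (\<lambda>_. N))"
      using sets.sets_into_space by auto
    then have "S = {} \<or> S = space (PiM K (\<lambda>_. N))"
      unfolding True space_PiM by auto
    then show "emeasure (distr M (PiM K (\<lambda>_. N)) (\<lambda>\<omega>. \<lambda>k\<in>K. X (p k) \<omega>)) S = emeasure (PiM K (\<lambda>_. N)) S"
      using D.emeasure_space_1 E.emeasure_space_1 by auto
  qed simp
next
  case False
  let ?R = "\<lambda>\<omega>. restrict (\<lambda>i. X i \<omega>) (p ` K)"
  have rv: "X i \<in> M \<rightarrow>\<^sub>M N" if "i \<in> I" for i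
    using indep that by (auto simp: indep_vars_def)
  have mR: "?R \<in> M \<rightarrow>\<^sub>M PiM (p ` K) (\<lambda>_. N)"
    using rv sub by (intro measurable_restrict) auto
  have "distr M (PiM (p ` K) (\<lambda>_. N)) ?R = PiM (p ` K) (\<lambda>i. distr M N (X i))"
    using indep_vars_subset[OF indep sub] False rv sub
    by (subst (asm) indep_vars_iff_distr_eq_PiM') auto
  also have "\<dots> = PiM (p ` K) (\<lambda>_. N)"
    using law sub by (intro PiM_cong) auto
  finally have R: "distr M (PiM (p ` K) (\<lambda>_. N)) ?R = PiM (p ` K) (\<lambda>_. N)" .
  have "distr M (PiM K (\<lambda>_. N)) (\<lambda>\<omega>. \<lambda>k\<in>K. X (p k) \<omega>)
      = distr (distr M (PiM (p ` K) (\<lambda>_. N)) ?R) (PiM K (\<lambda>_. N)) (\<lambda>f. \<lambda>k\<in>K. f (p k))"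
    using mR by (subst distr_distr)
      (auto simp: comp_def intro!: distr_cong measurable_restrict measurable_component_singleton)
  also have "\<dots> = PiM K (\<lambda>_. N)"
    unfolding R by (intro distr_PiM_reindex N inj) auto
  finally show ?thesis .
qed

text \<open>
  The orthogonality behind Hoeffding's decomposition. If only the \<open>k\<close>-th index of \<open>p\<close> may occur
  in \<open>q\<close>, the variables at the other indices of \<open>p\<close> are independent of everything else in the
  product; integrating them out first leaves \<open>\<integral>y. r (y(k := t))\<close> at \<open>t = X (p k)\<close>, which is
  \<open>0\<close>.
\<close>

lemma (in prob_space) expectation_degenerate_mult_eq_0:
  fixes X :: "nat \<Rightarrow> 'a \<Rightarrow> 'b" and r s :: "(nat \<Rightarrow> 'b) \<Rightarrow> real"
  assumes N: "prob_space N"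
    and indep: "indep_vars (\<lambda>_. N) X I"
    and law: "\<And>i. i \<in> I \<Longrightarrow> distr M N (X i) = N"
    and r[measurable]: "r \<in> borel_measurable (PiM {..<m} (\<lambda>_. N))"
    and s[measurable]: "s \<in> borel_measurable (PiM {..<m} (\<lambda>_. N))"
    and bdr: "\<And>y. y \<in> space (PiM {..<m} (\<lambda>_. N)) \<Longrightarrow> \<bar>r y\<bar> \<le> C"
    and bds: "\<And>y. y \<in> space (PiM {..<m} (\<lambda>_. N)) \<Longrightarrow> \<bar>s y\<bar> \<le> D"
    and p: "inj_on p {..<m}" "p ` {..<m} \<subseteq> I" and q: "q ` {..<m} \<subseteq> I"
    and k: "k < m" and disj: "p ` ({..<m} - {k}) \<inter> q ` {..<m} = {}"
    and deg: "\<And>t. t \<in> space N \<Longrightarrow> (\<integral>y. r (y(k := t)) \<partial>PiM ({..<m} - {k}) (\<lambda>_. N)) = 0"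
  shows "expectation (\<lambda>\<omega>. r (\<lambda>j\<in>{..<m}. X (p j) \<omega>) * s (\<lambda>j\<in>{..<m}. X (q j) \<omega>)) = 0"
proof -
  \<comment> \<open>\<open>A\<close> holds the argument positions to be integrated out, \<open>B\<close> the sample indices that stay fixed.\<close>
  define A where "A = {..<m} - {k}"
  define B where "B = insert (p k) (q ` {..<m})"
  define PA where "PA = PiM A (\<lambda>_. N)"
  define PB where "PB = PiM B (\<lambda>_. N)"
  define Y where "Y \<omega> = (\<lambda>j\<in>A. X (p j) \<omega>)" for \<omega>
  define Z where "Z \<omega> = (\<lambda>i\<in>B. X i \<omega>)" for \<omega>
  define F where "F z y = r (y(k := z (p k))) * s (\<lambda>j\<in>{..<m}. z (q j))" for z y
  have mA: "{..<m} = A \<union> {k}" using k by (auto simp: A_def)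
  have pq[simp]: "p k \<in> B" "\<And>j. j < m \<Longrightarrow> q j \<in> B" by (auto simp: B_def)
  have rs[measurable]: "(\<lambda>f. \<lambda>j\<in>A. f (p j)) \<in> PiM (p ` A) (\<lambda>_. N) \<rightarrow>\<^sub>M PA"
    unfolding PA_def by (intro measurable_restrict measurable_component_singleton) auto
  have indepZY: "indep_var PB Z PA Y"
  proof -
    have "B \<inter> p ` A = {}" "B \<subseteq> I" "p ` A \<subseteq> I"
      using disj p q k by (auto simp: B_def A_def inj_on_def)
    from indep_var_restrict[OF indep this]
    have "indep_var PB Z (PiM (p ` A) (\<lambda>_. N)) (\<lambda>\<omega>. \<lambda>i\<in>p ` A. X i \<omega>)"
      unfolding PB_def Z_def[abs_def] .
    from indep_var_compose[OF this measurable_ident rs]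
    show ?thesis
      by (simp add: comp_def Y_def[abs_def] cong: restrict_cong)
  qed
  then have [measurable]: "Z \<in> M \<rightarrow>\<^sub>M PB" "Y \<in> M \<rightarrow>\<^sub>M PA"
    by (auto dest: indep_var_rv1 indep_var_rv2)
  have upd[measurable]: "(\<lambda>x. (snd x)(k := fst x (p k))) \<in> PB \<Otimes>\<^sub>M PA \<rightarrow>\<^sub>M PiM {..<m} (\<lambda>_. N)"
    unfolding PA_def PB_def
    by (rule measurable_fun_upd[OF mA]) (auto intro!: measurable_compose[OF measurable_fst] measurable_component_singleton)
  have res[measurable]: "(\<lambda>z. \<lambda>j\<in>{..<m}. z (q j)) \<in> PB \<rightarrow>\<^sub>M PiM {..<m} (\<lambda>_. N)"
    unfolding PB_def by (intro measurable_restrict measurable_component_singleton) auto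
  have mF[measurable]: "(\<lambda>x. F (fst x) (snd x)) \<in> borel_measurable (PB \<Otimes>\<^sub>M PA)"
    unfolding F_def by measurable
  have lawY: "distr M PA Y = PA"
    unfolding PA_def Y_def using p by (intro distr_iid_reindex[OF N indep law]) (auto simp: A_def inj_on_def)
  interpret PA: prob_space PA unfolding PA_def by (intro prob_space_PiM N)
  interpret ZP: prob_space "distr M PB Z" by (rule prob_space_distr) simp
  interpret ZA: pair_prob_space "distr M PB Z" PA ..
  have bdF: "\<bar>F z y\<bar> \<le> C * D" if "z \<in> space PB" "y \<in> space PA" for z y
  proof -
    have "y(k := z (p k)) \<in> space (PiM {..<m} (\<lambda>_. N))" "(\<lambda>j\<in>{..<m}. z (q j)) \<in> space (PiM {..<m} (\<lambda>_. N))"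
      using measurable_space[OF upd, of "(z, y)"] measurable_space[OF res, of z] that
      by (auto simp: space_pair_measure)
    from bdr[OF this(1)] bds[OF this(2)] show ?thesis
      unfolding F_def abs_mult by (intro mult_mono) auto
  qed
  have "expectation (\<lambda>\<omega>. r (\<lambda>j\<in>{..<m}. X (p j) \<omega>) * s (\<lambda>j\<in>{..<m}. X (q j) \<omega>))
      = expectation (\<lambda>\<omega>. F (Z \<omega>) (Y \<omega>))"
  proof (rule Bochner_Integration.integral_cong[OF refl])
    fix \<omega>
    have "(Y \<omega>)(k := Z \<omega> (p k)) = (\<lambda>j\<in>{..<m}. X (p j) \<omega>)"
      using k by (auto simp: Y_def Z_def A_def fun_eq_iff)
    moreover have "(\<lambda>j\<in>{..<m}. Z \<omega> (q j)) = (\<lambda>j\<in>{..<m}. X (q j) \<omega>)"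
      by (auto simp: Z_def fun_eq_iff)
    ultimately show "r (\<lambda>j\<in>{..<m}. X (p j) \<omega>) * s (\<lambda>j\<in>{..<m}. X (q j) \<omega>) = F (Z \<omega>) (Y \<omega>)"
      by (simp add: F_def)
  qed
  also have "\<dots> = (\<integral>x. F (fst x) (snd x) \<partial>distr M (PB \<Otimes>\<^sub>M PA) (\<lambda>\<omega>. (Z \<omega>, Y \<omega>)))"
    by (subst integral_distr) auto
  also have "distr M (PB \<Otimes>\<^sub>M PA) (\<lambda>\<omega>. (Z \<omega>, Y \<omega>)) = distr M PB Z \<Otimes>\<^sub>M PA"
    using indepZY unfolding indep_var_distribution_eq lawY by simp
  also have "(\<integral>x. F (fst x) (snd x) \<partial>(distr M PB Z \<Otimes>\<^sub>M PA))
      = (\<integral>z. (\<integral>y. F z y \<partial>PA) \<partial>distr M PB Z)"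
  proof (subst ZA.integral_fst'[symmetric])
    show "integrable (distr M PB Z \<Otimes>\<^sub>M PA) (\<lambda>x. F (fst x) (snd x))"
      by (rule ZA.P.integrable_const_bound[of _ "C * D"])
         (auto intro!: AE_I2 bdF simp: space_pair_measure)
  qed simp
  also have "\<dots> = (\<integral>z. 0 \<partial>distr M PB Z)"
  proof (rule Bochner_Integration.integral_cong[OF refl])
    fix z assume "z \<in> space (distr M PB Z)"
    then have "z (p k) \<in> space N"
      by (auto simp: PB_def space_PiM PiE_iff)
    from deg[OF this] show "(\<integral>y. F z y \<partial>PA) = 0"
      by (simp add: F_def PA_def A_def)
  qed
  also have "\<dots> = 0" by simp
  finally show ?thesis .
qed

text \<open>
  The setting of V-statistics: an i.i.d. sample with law \<open>N\<close> and a bounded kernel \<open>h\<close> of \<open>m\<close>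
  arguments, given as a function on the product space over \<open>{..<m}\<close>. The kernels of interest
  are not symmetric, so each argument position has a projection of its own.
\<close>

locale iid_kernel = prob_space M + N: prob_space N for M :: "'a measure" and N :: "'b measure" +
  fixes X :: "nat \<Rightarrow> 'a \<Rightarrow> 'b" and m :: nat and h :: "(nat \<Rightarrow> 'b) \<Rightarrow> real" and C :: real
  assumes indep: "indep_vars (\<lambda>_. N) X {1..}"
    and law: "\<And>i. i \<in> {1..} \<Longrightarrow> distr M N (X i) = N"
    and h_measurable [measurable]: "h \<in> borel_measurable (PiM {..<m} (\<lambda>_. N))"
    and h_bounded: "\<And>y. y \<in> space (PiM {..<m} (\<lambda>_. N)) \<Longrightarrow> \<bar>h y\<bar> \<le> C"
    and m_pos: "0 < m"
begin

definition tuples :: "nat \<Rightarrow> (nat \<Rightarrow> nat) set" where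
  "tuples n = {..<m} \<rightarrow>\<^sub>E {1..n}"

definition h_at :: "(nat \<Rightarrow> nat) \<Rightarrow> 'a \<Rightarrow> real" where
  "h_at p \<omega> = h (\<lambda>k\<in>{..<m}. X (p k) \<omega>)"

text \<open>
  The sum runs over all index tuples, not only over injective ones. This makes the projection part
  of the decomposition an exact sum over the sample; the tuples with repetitions contribute
  a lower order.
\<close>

definition vsum :: "nat \<Rightarrow> 'a \<Rightarrow> real" where
  "vsum n \<omega> = (\<Sum>p\<in>tuples n. h_at p \<omega>)"

lemma finite_tuples [simp]: "finite (tuples n)"
  unfolding tuples_def by (intro finite_PiE) auto

lemma card_tuples [simp]: "card (tuples n) = n ^ m"
  by (simp add: tuples_def card_PiE)

lemma tuples_ge_1: "p \<in> tuples n \<Longrightarrow> k < m \<Longrightarrow> p k \<ge> 1"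
  unfolding tuples_def using PiE_mem[of p "{..<m}" "\<lambda>_. {1..n}" k] by simp

lemma X_measurable: "i \<ge> 1 \<Longrightarrow> X i \<in> M \<rightarrow>\<^sub>M N"
  using indep by (auto simp: indep_vars_def)

lemma tuple_measurable:
  "p \<in> tuples n \<Longrightarrow> (\<lambda>\<omega>. \<lambda>k\<in>{..<m}. X (p k) \<omega>) \<in> M \<rightarrow>\<^sub>M PiM {..<m} (\<lambda>_. N)"
  by (intro measurable_restrict X_measurable) (simp only: lessThan_iff tuples_ge_1)

lemma h_at_measurable: "p \<in> tuples n \<Longrightarrow> h_at p \<in> borel_measurable M"
  unfolding h_at_def[abs_def] by (rule measurable_compose[OF _ h_measurable]) (rule tuple_measurable)

lemma h_at_bounded:
  assumes "p \<in> tuples n" "\<omega> \<in> space M"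
  shows "\<bar>h_at p \<omega>\<bar> \<le> C"
  unfolding h_at_def by (rule h_bounded) (rule measurable_space[OF tuple_measurable[OF assms(1)] assms(2)])

lemma C_nonneg: "0 \<le> C"
proof -
  interpret Y: prob_space "PiM {..<m} (\<lambda>_. N)" by (intro prob_space_PiM N.prob_space_axioms)
  obtain y where "y \<in> space (PiM {..<m} (\<lambda>_. N))" using Y.not_empty by blast
  from h_bounded[OF this] show ?thesis by linarith
qed

lemma measurable_vsum [measurable]: "vsum n \<in> borel_measurable M"
  unfolding vsum_def[abs_def] by (intro borel_measurable_sum h_at_measurable)

lemma vsum_bounded:
  assumes "\<omega> \<in> space M"
  shows "\<bar>vsum n \<omega>\<bar> \<le> real n ^ m * C"
proof -
  have "\<bar>vsum n \<omega>\<bar> \<le> (\<Sum>p\<in>tuples n. C)"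
    unfolding vsum_def by (intro order.trans[OF sum_abs] sum_mono h_at_bounded[OF _ assms])
  then show ?thesis by simp
qed

end

text \<open>
  First-order degeneracy: the conditional mean of the kernel given any single
  argument vanishes.
\<close>

locale degenerate_kernel = iid_kernel +
  assumes degenerate: "\<And>k t. k < m \<Longrightarrow> t \<in> space N \<Longrightarrow>
    (\<integral>y. h (y(k := t)) \<partial>PiM ({..<m} - {k}) (\<lambda>_. N)) = 0"
begin

text \<open>
  In the expansion of the square, a pair of injective tuples that share at most one index
  contributes \<open>0\<close>, so it suffices to count the pairs with at most \<open>2 * m - 2\<close> values.
\<close>

lemma expectation_injective_part_square_le:
  assumes "n \<ge> 1"
  defines "J \<equiv> {p \<in> tuples n. inj_on p {..<m}}"
  shows "expectation (\<lambda>\<omega>. (\<Sum>p\<in>J. h_at p \<omega>)\<^sup>2)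
    \<le> C\<^sup>2 * (real n ^ (2 * m - 2) * real (2 * m - 2) ^ (2 * m))"
proof -
  let ?B = "{(p, q) \<in> tuples n \<times> tuples n. card (p ` {..<m} \<union> q ` {..<m}) \<le> 2 * m - 2}"
  have int: "integrable M (\<lambda>\<omega>. h_at p \<omega> * h_at q \<omega>)" if "p \<in> tuples n" "q \<in> tuples n" for p q
  proof (rule integrable_const_bound[of _ "C * C"])
    show "AE \<omega> in M. norm (h_at p \<omega> * h_at q \<omega>) \<le> C * C"
      using h_at_bounded[OF that(1)] h_at_bounded[OF that(2)] C_nonneg
      by (auto simp: abs_mult intro!: AE_I2 mult_mono)
  qed (intro borel_measurable_times h_at_measurable[OF that(1)] h_at_measurable[OF that(2)])
  have "expectation (\<lambda>\<omega>. (\<Sum>p\<in>J. h_at p \<omega>)\<^sup>2)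
      = expectation (\<lambda>\<omega>. \<Sum>(p, q)\<in>J \<times> J. h_at p \<omega> * h_at q \<omega>)"
    by (simp add: power2_eq_square sum_product sum.cartesian_product)
  also have "\<dots> = (\<Sum>(p, q)\<in>J \<times> J. expectation (\<lambda>\<omega>. h_at p \<omega> * h_at q \<omega>))"
    unfolding case_prod_unfold
    by (intro Bochner_Integration.integral_sum int) (auto simp: J_def)
  also have "\<dots> \<le> (\<Sum>(p, q)\<in>J \<times> J. C\<^sup>2 * of_bool ((p, q) \<in> ?B))"
  proof (intro sum_mono, clarify)
    fix p q assume pq: "p \<in> J" "q \<in> J"
    then have P: "p \<in> tuples n" "q \<in> tuples n" and inj: "inj_on p {..<m}" "inj_on q {..<m}"
      by (auto simp: J_def)
    show "expectation (\<lambda>\<omega>. h_at p \<omega> * h_at q \<omega>) \<le> C\<^sup>2 * of_bool ((p, q) \<in> ?B)"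
    proof (cases "(p, q) \<in> ?B")
      case True
      have "expectation (\<lambda>\<omega>. h_at p \<omega> * h_at q \<omega>) \<le> expectation (\<lambda>\<omega>. C * C)"
      proof (rule integral_mono[OF int[OF P]])
        fix \<omega> assume "\<omega> \<in> space M"
        have "h_at p \<omega> * h_at q \<omega> \<le> \<bar>h_at p \<omega>\<bar> * \<bar>h_at q \<omega>\<bar>"
          by (metis abs_ge_self abs_mult)
        also have "\<dots> \<le> C * C"
          by (intro mult_mono h_at_bounded[OF P(1)] h_at_bounded[OF P(2)] \<open>\<omega> \<in> space M\<close> C_nonneg) auto
        finally show "h_at p \<omega> * h_at q \<omega> \<le> C * C" .
      qed simp
      then show ?thesis using True by (simp add: power2_eq_square prob_space)
    next
      case False
      with P have far: "\<not> card (p ` {..<m} \<union> q ` {..<m}) \<le> 2 * card {..<m} - 2" by auto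
      have "{..<m} \<noteq> {}" using m_pos by auto
      from nearly_disjoint_images[OF finite_lessThan this inj far]
      obtain k where k: "k < m" "p ` ({..<m} - {k}) \<inter> q ` {..<m} = {}" by auto
      have sub: "p ` {..<m} \<subseteq> {1..}" "q ` {..<m} \<subseteq> {1..}"
        using tuples_ge_1[OF P(1)] tuples_ge_1[OF P(2)] by (auto simp: image_subset_iff)
      have "expectation (\<lambda>\<omega>. h_at p \<omega> * h_at q \<omega>) = 0"
        unfolding h_at_def
        by (rule expectation_degenerate_mult_eq_0[OF N.prob_space_axioms indep law h_measurable h_measurable
              h_bounded h_bounded inj(1) sub k degenerate[OF k(1)]])
      then show ?thesis using False by simp
    qed
  qed
  also have "\<dots> \<le> (\<Sum>(p, q)\<in>tuples n \<times> tuples n. C\<^sup>2 * of_bool ((p, q) \<in> ?B))"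
    by (rule sum_mono2) (auto simp: J_def)
  also have "\<dots> = (\<Sum>x\<in>tuples n \<times> tuples n. C\<^sup>2 * of_bool (x \<in> ?B))"
    by (simp add: case_prod_unfold)
  also have "\<dots> = C\<^sup>2 * card ?B"
  proof -
    have "tuples n \<times> tuples n \<inter> {x. x \<in> ?B} = ?B" by auto
    then show ?thesis by (simp add: of_bool_def sum.If_cases flip: sum_distrib_left)
  qed
  also have "\<dots> \<le> C\<^sup>2 * (real n ^ (2 * m - 2) * real (2 * m - 2) ^ (2 * m))"
  proof (rule mult_left_mono)
    have "card ?B \<le> card {1..n} ^ (2 * m - 2) * (2 * m - 2) ^ (2 * m)"
      unfolding tuples_def using \<open>n \<ge> 1\<close> by (intro card_overlapping_pairs_le) auto
    then have "real (card ?B) \<le> real (n ^ (2 * m - 2) * (2 * m - 2) ^ (2 * m))"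
      unfolding card_atLeastAtMost by (simp only: of_nat_le_iff diff_Suc_1)
    then show "real (card ?B) \<le> real n ^ (2 * m - 2) * real (2 * m - 2) ^ (2 * m)"
      by (simp only: of_nat_mult of_nat_power)
  qed simp
  finally show ?thesis .
qed

text \<open>
  A general kernel has a sum of order \<open>n ^ m\<close> with fluctuations of order \<open>n ^ m / sqrt n\<close>;
  degeneracy saves a full power of \<open>n\<close>. For the injective tuples this is the square bound above, and
  there are only \<open>O(n ^ (m - 1))\<close> tuples with a repetition.
\<close>

lemma expectation_abs_vsum_le:
  assumes "n \<ge> 1"
  shows "expectation (\<lambda>\<omega>. \<bar>vsum n \<omega>\<bar>)
    \<le> C * (real (2 * m - 2) ^ m + real (m - 1) ^ m) * real n ^ (m - 1)"
proof -
  define J where "J = {p \<in> tuples n. inj_on p {..<m}}"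
  let ?S = "\<lambda>\<omega>. \<Sum>p\<in>J. h_at p \<omega>"
  have [measurable]: "?S \<in> borel_measurable M"
    by (intro borel_measurable_sum h_at_measurable) (auto simp: J_def)
  have bS: "\<bar>?S \<omega>\<bar> \<le> real (card J) * C" if "\<omega> \<in> space M" for \<omega>
  proof -
    have "\<bar>?S \<omega>\<bar> \<le> (\<Sum>p\<in>J. \<bar>h_at p \<omega>\<bar>)" by (rule sum_abs)
    also have "\<dots> \<le> real (card J) * C"
      by (rule sum_bounded_above) (use h_at_bounded[OF _ that] in \<open>auto simp: J_def\<close>)
    finally show ?thesis .
  qed
  have intS: "integrable M (\<lambda>\<omega>. \<bar>?S \<omega>\<bar>)"
    by (rule integrable_const_bound[of _ "real (card J) * C"]) (auto intro!: AE_I2 bS)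
  have intS2: "integrable M (\<lambda>\<omega>. \<bar>?S \<omega>\<bar>\<^sup>2)"
    by (rule integrable_const_bound[of _ "(real (card J) * C)\<^sup>2"])
       (use power_mono[OF bS, of _ 2] in \<open>auto intro!: AE_I2\<close>)
  have rest: "real (card (tuples n - J)) \<le> real n ^ (m - 1) * real (m - 1) ^ m"
  proof -
    have "tuples n - J \<subseteq> {s \<in> tuples n. card (s ` {..<m}) \<le> m - 1}"
    proof
      fix s assume s: "s \<in> tuples n - J"
      then have "card (s ` {..<m}) \<noteq> m"
        using eq_card_imp_inj_on[of "{..<m}" s] by (auto simp: J_def)
      moreover have "card (s ` {..<m}) \<le> m"
        using card_image_le[of "{..<m}" s] by simp
      ultimately show "s \<in> {s \<in> tuples n. card (s ` {..<m}) \<le> m - 1}" using s by simp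
    qed
    then have "card (tuples n - J) \<le> card {s \<in> tuples n. card (s ` {..<m}) \<le> m - 1}"
      by (intro card_mono) auto
    also have "\<dots> \<le> n ^ (m - 1) * (m - 1) ^ m"
      unfolding tuples_def using card_PiE_range_le[of "{1..n}" m "m - 1"] \<open>n \<ge> 1\<close> by simp
    finally have "real (card (tuples n - J)) \<le> real (n ^ (m - 1) * (m - 1) ^ m)"
      by (simp only: of_nat_le_iff)
    then show ?thesis by (simp only: of_nat_mult of_nat_power)
  qed
  have "(expectation (\<lambda>\<omega>. \<bar>?S \<omega>\<bar>))\<^sup>2 \<le> expectation (\<lambda>\<omega>. \<bar>?S \<omega>\<bar>\<^sup>2)"
    using variance_eq[OF intS intS2] variance_positive[of "\<lambda>\<omega>. \<bar>?S \<omega>\<bar>"] by simp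
  also have "\<dots> \<le> C\<^sup>2 * (real n ^ (2 * m - 2) * real (2 * m - 2) ^ (2 * m))"
    using expectation_injective_part_square_le[OF assms] by (simp add: J_def)
  also have "\<dots> = (C * real (2 * m - 2) ^ m * real n ^ (m - 1))\<^sup>2"
    by (simp add: power_mult_distrib power_mult[symmetric] mult.commute right_diff_distrib')
  finally have main: "expectation (\<lambda>\<omega>. \<bar>?S \<omega>\<bar>) \<le> C * real (2 * m - 2) ^ m * real n ^ (m - 1)"
    by (rule power2_le_imp_le) (intro mult_nonneg_nonneg C_nonneg; simp)
  have "expectation (\<lambda>\<omega>. \<bar>vsum n \<omega>\<bar>) \<le> expectation (\<lambda>\<omega>. \<bar>?S \<omega>\<bar> + real (card (tuples n - J)) * C)"
  proof (rule integral_mono)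
    show "integrable M (\<lambda>\<omega>. \<bar>vsum n \<omega>\<bar>)"
      by (rule integrable_const_bound[of _ "real n ^ m * C"]) (auto intro!: AE_I2 vsum_bounded)
    show "integrable M (\<lambda>\<omega>. \<bar>?S \<omega>\<bar> + real (card (tuples n - J)) * C)"
      using intS by simp
    fix \<omega> assume \<omega>: "\<omega> \<in> space M"
    have "vsum n \<omega> = ?S \<omega> + (\<Sum>p\<in>tuples n - J. h_at p \<omega>)"
      unfolding vsum_def using sum.subset_diff[of J "tuples n" "\<lambda>p. h_at p \<omega>"] by (auto simp: J_def)
    moreover have "\<bar>\<Sum>p\<in>tuples n - J. h_at p \<omega>\<bar> \<le> real (card (tuples n - J)) * C"
    proof -
      have "\<bar>\<Sum>p\<in>tuples n - J. h_at p \<omega>\<bar> \<le> (\<Sum>p\<in>tuples n - J. \<bar>h_at p \<omega>\<bar>)" by (rule sum_abs)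
      also have "\<dots> \<le> real (card (tuples n - J)) * C"
        by (rule sum_bounded_above) (use h_at_bounded[OF _ \<omega>] in auto)
      finally show ?thesis .
    qed
    ultimately show "\<bar>vsum n \<omega>\<bar> \<le> \<bar>?S \<omega>\<bar> + real (card (tuples n - J)) * C" by linarith
  qed
  also have "\<dots> = expectation (\<lambda>\<omega>. \<bar>?S \<omega>\<bar>) + real (card (tuples n - J)) * C"
    using intS by (simp add: prob_space)
  also have "\<dots> \<le> C * real (2 * m - 2) ^ m * real n ^ (m - 1) + (real n ^ (m - 1) * real (m - 1) ^ m) * C"
    by (intro add_mono main mult_right_mono rest C_nonneg)
  finally show ?thesis by (simp add: algebra_simps)
qed

end

section \<open>The central limit theorem for V-statistics\<close>

context iid_kernel
begin

definition rest :: "nat \<Rightarrow> (nat \<Rightarrow> 'b) measure" where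
  "rest k = PiM ({..<m} - {k}) (\<lambda>_. N)"

definition mean :: real where
  "mean = (\<integral>y. h y \<partial>PiM {..<m} (\<lambda>_. N))"

text \<open>
  The Hajek projection: the mean of the kernel given that its \<open>k\<close>-th argument is \<open>t\<close>.
\<close>

definition proj :: "nat \<Rightarrow> 'b \<Rightarrow> real" where
  "proj k t = (\<integral>y. h (y(k := t)) \<partial>rest k)"

text \<open>
  Since a sample point may stand at any of the \<open>m\<close> positions, its first-order effect on the
  V-statistic is the sum of the centred projections.
\<close>

definition influence :: "'b \<Rightarrow> real" where
  "influence t = (\<Sum>k<m. proj k t - mean)"

definition remainder :: "(nat \<Rightarrow> 'b) \<Rightarrow> real" where
  "remainder y = h y - mean - (\<Sum>k<m. proj k (y k) - mean)"

lemma prob_space_PiM_N: "prob_space (PiM K (\<lambda>_. N))"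
  by (intro prob_space_PiM N.prob_space_axioms)

lemma prob_space_rest: "prob_space (rest k)"
  unfolding rest_def by (rule prob_space_PiM_N)

lemma upd_measurable:
  assumes "k < m"
  shows "(\<lambda>(t, y). y(k := t)) \<in> N \<Otimes>\<^sub>M rest k \<rightarrow>\<^sub>M PiM {..<m} (\<lambda>_. N)"
proof -
  have "{..<m} = ({..<m} - {k}) \<union> {k}" using assms by auto
  then show ?thesis
    unfolding rest_def case_prod_unfold by (rule measurable_fun_upd) auto
qed

lemma h_upd_measurable:
  "k < m \<Longrightarrow> (\<lambda>(t, y). h (y(k := t))) \<in> borel_measurable (N \<Otimes>\<^sub>M rest k)"
  using measurable_compose[OF upd_measurable h_measurable] by (simp add: case_prod_unfold)

lemma upd_space: "k < m \<Longrightarrow> t \<in> space N \<Longrightarrow> y \<in> space (rest k) \<Longrightarrow> y(k := t) \<in> space (PiM {..<m} (\<lambda>_. N))"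
  using measurable_space[OF upd_measurable, of k "(t, y)"] by (simp add: space_pair_measure)

lemma h_upd_integrable:
  assumes "k < m" "t \<in> space N"
  shows "integrable (rest k) (\<lambda>y. h (y(k := t)))"
proof -
  interpret R: prob_space "rest k" by (rule prob_space_rest)
  have "(\<lambda>y. h (y(k := t))) \<in> borel_measurable (rest k)"
    using measurable_compose[OF measurable_Pair1'[OF assms(2)] h_upd_measurable[OF assms(1)]] by simp
  then show ?thesis
    by (intro R.integrable_const_bound[of _ C]) (use assms in \<open>auto intro!: AE_I2 h_bounded upd_space\<close>)
qed

lemma proj_measurable [measurable]:
  assumes "k < m"
  shows "proj k \<in> borel_measurable N"
proof -
  interpret R: prob_space "rest k" by (rule prob_space_rest)
  show ?thesis
    unfolding proj_def[abs_def] by (rule R.borel_measurable_lebesgue_integral[OF h_upd_measurable[OF assms]])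
qed

lemma proj_bounded:
  assumes "k < m" "t \<in> space N"
  shows "\<bar>proj k t\<bar> \<le> C"
proof -
  interpret R: prob_space "rest k" by (rule prob_space_rest)
  have "\<bar>proj k t\<bar> \<le> (\<integral>y. \<bar>h (y(k := t))\<bar> \<partial>rest k)"
    unfolding proj_def by (rule integral_abs_bound)
  also have "\<dots> \<le> (\<integral>y. C \<partial>rest k)"
    using h_upd_integrable[OF assms] upd_space[OF assms] h_bounded by (intro integral_mono) auto
  also have "\<dots> = C" by (simp add: R.prob_space)
  finally show ?thesis .
qed

lemma proj_integrable: "k < m \<Longrightarrow> integrable N (proj k)"
  by (intro N.integrable_const_bound[of _ C]) (auto intro!: AE_I2 proj_bounded proj_measurable)

lemma mean_bounded: "\<bar>mean\<bar> \<le> C"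
proof -
  interpret R: prob_space "PiM {..<m} (\<lambda>_. N)" by (rule prob_space_PiM_N)
  have i: "integrable (PiM {..<m} (\<lambda>_. N)) h"
    by (intro R.integrable_const_bound[of _ C]) (auto intro!: AE_I2 h_bounded)
  have "\<bar>mean\<bar> \<le> (\<integral>y. \<bar>h y\<bar> \<partial>PiM {..<m} (\<lambda>_. N))"
    unfolding mean_def by (rule integral_abs_bound)
  also have "\<dots> \<le> (\<integral>y. C \<partial>PiM {..<m} (\<lambda>_. N))"
    using i h_bounded by (intro integral_mono) auto
  also have "\<dots> = C" by (simp add: R.prob_space)
  finally show ?thesis .
qed

lemma integral_proj:
  assumes "k < m"
  shows "integral\<^sup>L N (proj k) = mean"
proof -
  interpret R: prob_space "rest k" by (rule prob_space_rest)
  interpret NR: pair_prob_space N "rest k" ..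
  interpret F: prob_space "PiM {..<m} (\<lambda>_. N)" by (rule prob_space_PiM_N)
  interpret pp: product_prob_space "\<lambda>_. N" "{..<m}" by standard
  have ins: "{..<m} = insert k ({..<m} - {k})" using assms by auto
  have "integrable (PiM {..<m} (\<lambda>_. N)) h"
    by (intro F.integrable_const_bound[of _ C]) (auto intro!: AE_I2 h_bounded)
  then have "mean = (\<integral>y. (\<integral>t. h (y(k := t)) \<partial>N) \<partial>rest k)"
    unfolding mean_def rest_def using ins by (metis pp.product_integral_insert finite_Diff finite_lessThan Diff_iff singletonI)
  also have "\<dots> = (\<integral>t. (\<integral>y. h (y(k := t)) \<partial>rest k) \<partial>N)"
  proof (rule NR.Fubini_integral)
    show "integrable (N \<Otimes>\<^sub>M rest k) (\<lambda>(t, y). h (y(k := t)))"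
      using assms h_upd_measurable
      by (intro NR.P.integrable_const_bound[of _ C])
         (auto intro!: AE_I2 h_bounded upd_space simp: space_pair_measure)
  qed
  finally show ?thesis by (simp add: proj_def[abs_def])
qed

lemma influence_measurable [measurable]: "influence \<in> borel_measurable N"
  unfolding influence_def[abs_def] by measurable

lemma influence_bounded:
  assumes "t \<in> space N"
  shows "\<bar>influence t\<bar> \<le> real m * (2 * C)"
proof -
  have "\<bar>influence t\<bar> \<le> (\<Sum>k<m. \<bar>proj k t - mean\<bar>)"
    unfolding influence_def by (rule sum_abs)
  also have "\<dots> \<le> (\<Sum>k<m. 2 * C)"
  proof (rule sum_mono)
    fix k assume "k \<in> {..<m}"
    then show "\<bar>proj k t - mean\<bar> \<le> 2 * C"
      using proj_bounded[OF _ assms, of k] mean_bounded by auto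
  qed
  finally show ?thesis by simp
qed

lemma integral_influence: "integral\<^sup>L N influence = 0"
  unfolding influence_def[abs_def]
  by (subst Bochner_Integration.integral_sum) (auto simp: proj_integrable integral_proj N.prob_space)

text \<open>
  Given the \<open>k\<close>-th argument, the kernel has mean \<open>proj k t\<close> and the projections at the other
  positions have mean \<open>mean\<close>, so everything in the remainder cancels.
\<close>

lemma degenerate_remainder:
  "degenerate_kernel M N X m remainder (C + C + real m * (2 * C))"
proof unfold_locales
  have "(\<lambda>y. proj k (y k)) \<in> borel_measurable (PiM {..<m} (\<lambda>_. N))" if "k < m" for k
    by (rule measurable_compose[where f = "\<lambda>y. y k" and N = N]) (use that in simp_all)
  then show "remainder \<in> borel_measurable (PiM {..<m} (\<lambda>_. N))"
    unfolding remainder_def[abs_def]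
    by (intro borel_measurable_diff borel_measurable_sum borel_measurable_const h_measurable) auto
  show "\<bar>remainder y\<bar> \<le> C + C + real m * (2 * C)" if y: "y \<in> space (PiM {..<m} (\<lambda>_. N))" for y
  proof -
    have "\<bar>\<Sum>k<m. proj k (y k) - mean\<bar> \<le> (\<Sum>k<m. 2 * C)"
    proof (intro order.trans[OF sum_abs] sum_mono)
      fix k assume k: "k \<in> {..<m}"
      then have "y k \<in> space N" using y by (auto simp: space_PiM dest: PiE_mem)
      then show "\<bar>proj k (y k) - mean\<bar> \<le> 2 * C"
        using proj_bounded[of k "y k"] mean_bounded k by auto
    qed
    then show ?thesis
      using h_bounded[OF y] mean_bounded unfolding remainder_def by auto
  qed
  show "(\<integral>y. remainder (y(k := t)) \<partial>PiM ({..<m} - {k}) (\<lambda>_. N)) = 0" if k: "k < m" and t: "t \<in> space N" for k t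
  proof -
    interpret R: prob_space "rest k" by (rule prob_space_rest)
    let ?A = "{..<m} - {k}"
    have comp: "distr (rest k) N (\<lambda>y. y j) = N" if "j \<in> ?A" for j
      unfolding rest_def using that by (intro distr_PiM_component N.prob_space_axioms)
    have cm: "(\<lambda>y. y j) \<in> rest k \<rightarrow>\<^sub>M N" if "j \<in> ?A" for j
      unfolding rest_def using that by (intro measurable_component_singleton)
    have int: "integrable (rest k) (\<lambda>y. proj j (y j))" and val: "(\<integral>y. proj j (y j) \<partial>rest k) = mean"
      if j: "j \<in> ?A" for j
    proof -
      have jm: "j < m" using j by simp
      show "integrable (rest k) (\<lambda>y. proj j (y j))"
        using proj_integrable[OF jm] integrable_distr_eq[OF cm[OF j] proj_measurable[OF jm]] comp[OF j] by simp
      show "(\<integral>y. proj j (y j) \<partial>rest k) = mean"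
        using integral_proj[OF jm] integral_distr[OF cm[OF j] proj_measurable[OF jm]] comp[OF j] by simp
    qed
    have "remainder (y(k := t)) = (h (y(k := t)) - proj k t) - (\<Sum>j\<in>?A. proj j (y j) - mean)" for y
    proof -
      have "(\<Sum>j<m. proj j ((y(k := t)) j) - mean) = proj k t - mean + (\<Sum>j\<in>?A. proj j ((y(k := t)) j) - mean)"
        using k by (subst sum.remove[of _ k]) auto
      also have "(\<Sum>j\<in>?A. proj j ((y(k := t)) j) - mean) = (\<Sum>j\<in>?A. proj j (y j) - mean)"
        by (intro sum.cong) auto
      finally show ?thesis by (simp add: remainder_def)
    qed
    then have "(\<integral>y. remainder (y(k := t)) \<partial>rest k)
        = (\<integral>y. (h (y(k := t)) - proj k t) - (\<Sum>j\<in>?A. proj j (y j) - mean) \<partial>rest k)"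
      by simp
    also have "\<dots> = (\<integral>y. h (y(k := t)) - proj k t \<partial>rest k) - (\<integral>y. (\<Sum>j\<in>?A. proj j (y j) - mean) \<partial>rest k)"
      by (intro Bochner_Integration.integral_diff Bochner_Integration.integrable_diff
          Bochner_Integration.integrable_sum R.integrable_const h_upd_integrable k t int)
    also have "(\<integral>y. h (y(k := t)) - proj k t \<partial>rest k) = 0"
      using h_upd_integrable[OF k t] by (simp add: proj_def R.prob_space)
    also have "(\<integral>y. (\<Sum>j\<in>?A. proj j (y j) - mean) \<partial>rest k) = 0"
      using int val by (subst Bochner_Integration.integral_sum) (auto simp: R.prob_space)
    finally show ?thesis by (simp only: rest_def diff_self)
  qed
qed (use indep law m_pos in auto)

text \<open>
  Exact, because each sample index occurs at position \<open>k\<close> in precisely \<open>n ^ (m - 1)\<close> of the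
  tuples.
\<close>

lemma vsum_decomposition:
  "vsum n \<omega> = real n ^ m * mean + real n ^ (m - 1) * (\<Sum>i = 1..n. influence (X i \<omega>))
     + (\<Sum>p\<in>tuples n. remainder (\<lambda>k\<in>{..<m}. X (p k) \<omega>))"
proof -
  have "(\<Sum>p\<in>tuples n. \<Sum>k<m. proj k (X (p k) \<omega>) - mean)
      = (\<Sum>k<m. real (card {1..n}) ^ (m - 1) * (\<Sum>i = 1..n. proj k (X i \<omega>) - mean))"
    unfolding tuples_def
    by (subst sum.swap) (intro sum.cong refl sum_PiE_component[where f = "\<lambda>i. proj _ (X i \<omega>) - mean"]; simp)
  also have "\<dots> = real n ^ (m - 1) * (\<Sum>i = 1..n. influence (X i \<omega>))"
    unfolding influence_def sum_distrib_left[symmetric] by (subst sum.swap) simp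
  finally have "(\<Sum>p\<in>tuples n. \<Sum>k<m. proj k (X (p k) \<omega>) - mean)
      = real n ^ (m - 1) * (\<Sum>i = 1..n. influence (X i \<omega>))" .
  then show ?thesis
    by (simp add: vsum_def h_at_def remainder_def sum_subtractf sum.distrib)
qed

text \<open>
  The classical central limit theorem governs the sum of the influences, and the remainder is of
  order \<open>1 / n\<close> in \<open>L1\<close>, hence negligible after multiplication by \<open>sqrt n\<close>.
\<close>

theorem vstatistic_clt:
  assumes "\<sigma> > 0" and var: "(\<integral>t. (influence t)\<^sup>2 \<partial>N) = \<sigma>\<^sup>2"
  shows "weak_conv_m (\<lambda>n. distr M borel (\<lambda>\<omega>. sqrt (real n) * (vsum n \<omega> / real n ^ m - mean)))
    (density lborel (normal_density 0 \<sigma>))"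
proof -
  interpret R: degenerate_kernel M N X m remainder "C + C + real m * (2 * C)"
    by (rule degenerate_remainder)
  let ?C = "C + C + real m * (2 * C)"
  define K where "K = ?C * (real (2 * m - 2) ^ m + real (m - 1) ^ m)"
  define A where "A n \<omega> = (\<Sum>i = 1..n. influence (X i \<omega>)) / sqrt n" for n \<omega>
  define B where "B n \<omega> = sqrt (real n) * (vsum n \<omega> / real n ^ m - mean)" for n \<omega>
  have mY[measurable]: "(\<lambda>\<omega>. influence (X i \<omega>)) \<in> borel_measurable M" if "i \<ge> 1" for i
    using measurable_compose[OF X_measurable[OF that] influence_measurable] .
  have mA[measurable]: "A n \<in> borel_measurable M" for n
    unfolding A_def[abs_def] by (intro borel_measurable_divide borel_measurable_sum mY) auto
  have mB[measurable]: "B n \<in> borel_measurable M" for n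
    unfolding B_def[abs_def] by measurable
  have AB: "A n \<omega> - B n \<omega> = - (sqrt n / real n ^ m) * R.vsum n \<omega>" if "n \<ge> 1" for n \<omega>
  proof -
    have n: "real n > 0" using that by simp
    have pow: "real n ^ m = real n * real n ^ (m - 1)" using m_pos by (cases m) auto
    have "sqrt n * ((real n ^ m * mean + real n ^ (m - 1) * S + V) / real n ^ m - mean)
        = S / sqrt n + sqrt n / real n ^ m * V" for S V
    proof -
      have "(real n ^ m * mean + real n ^ (m - 1) * S + V) / real n ^ m - mean
          = S / real n + V / real n ^ m"
        using n by (simp add: pow field_simps)
      moreover have "sqrt n * (S / real n) = S / sqrt n"
        using n by (simp add: field_simps)
      ultimately show ?thesis by (simp add: distrib_left)
    qed
    then show ?thesis
      unfolding A_def B_def vsum_decomposition R.vsum_def R.h_at_def R.tuples_def tuples_def by simp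
  qed
  have AB0: "A 0 \<omega> - B 0 \<omega> = 0" for \<omega> by (simp add: A_def B_def)
  have intR: "integrable M (R.vsum n)" for n
  proof (rule integrable_const_bound)
    show "AE \<omega> in M. norm (R.vsum n \<omega>) \<le> real n ^ m * ?C"
      unfolding real_norm_def by (rule AE_I2) (rule R.vsum_bounded)
  qed (rule R.measurable_vsum)
  have int: "integrable M (\<lambda>\<omega>. A n \<omega> - B n \<omega>)" for n
    using intR[of n] by (cases "n = 0") (auto simp: AB AB0)
  have bound: "expectation (\<lambda>\<omega>. \<bar>A n \<omega> - B n \<omega>\<bar>) \<le> K / sqrt n" if n: "n \<ge> 1" for n
  proof -
    have "expectation (\<lambda>\<omega>. \<bar>A n \<omega> - B n \<omega>\<bar>) = sqrt n / real n ^ m * expectation (\<lambda>\<omega>. \<bar>R.vsum n \<omega>\<bar>)"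
      by (simp add: AB[OF n] abs_mult)
    also have "\<dots> \<le> sqrt n / real n ^ m * (K * real n ^ (m - 1))"
      unfolding K_def by (intro mult_left_mono R.expectation_abs_vsum_le n) auto
    also have "\<dots> = K / sqrt n"
    proof -
      have "real n ^ m = real n * real n ^ (m - 1)" using m_pos by (cases m) auto
      then show ?thesis using n by (simp add: field_simps)
    qed
    finally show ?thesis .
  qed
  have iid: "indep_vars (\<lambda>_. borel) (\<lambda>i \<omega>. influence (X i \<omega>)) {1..}"
    by (rule indep_vars_compose2[OF indep]) simp
  have idist: "distr M borel (\<lambda>\<omega>. influence (X i \<omega>)) = distr N borel influence" if "i \<ge> 1" for i
    using that law[of i] distr_distr[OF influence_measurable X_measurable[OF that]]
    by (simp add: comp_def)
  have sq: "integrable (distr N borel influence) (\<lambda>x. x\<^sup>2)"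
  proof (subst integrable_distr_eq)
    show "integrable N (\<lambda>t. (influence t)\<^sup>2)"
    proof (rule N.integrable_const_bound[of _ "(real m * (2 * C))\<^sup>2"])
      show "AE t in N. norm ((influence t)\<^sup>2) \<le> (real m * (2 * C))\<^sup>2"
        using power_mono[OF influence_bounded, of _ 2] by (auto intro!: AE_I2)
    qed simp
  qed auto
  have "weak_conv_m (\<lambda>n. distr M borel (A n)) (density lborel (normal_density 0 \<sigma>))"
    unfolding A_def[abs_def]
    by (rule clt_from_one[OF iid idist _ sq])
       (use \<open>\<sigma> > 0\<close> var integral_influence in \<open>simp_all add: integral_distr\<close>)
  then have "weak_conv_m (\<lambda>n. distr M borel (B n)) (density lborel (normal_density 0 \<sigma>))"
  proof (rule weak_conv_m_L1_close[rotated 3])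
    show "real_distribution (density lborel (normal_density 0 \<sigma>))"
      using \<open>\<sigma> > 0\<close> prob_space_normal_density[of \<sigma> 0]
      by (auto simp: real_distribution_def real_distribution_axioms_def)
    have "(\<lambda>n. K / sqrt (real n)) \<longlonglongrightarrow> 0" by real_asymp
    then show "(\<lambda>n. expectation (\<lambda>\<omega>. \<bar>A n \<omega> - B n \<omega>\<bar>)) \<longlonglongrightarrow> 0"
      by (rule tendsto_sandwich[OF _ _ tendsto_const, rotated 2])
         (auto intro!: eventually_sequentiallyI[of 1] bound)
  qed (use int in \<open>auto intro: always_eventually\<close>)
  then show ?thesis unfolding B_def[abs_def] .
qed

end

section \<open>Integration over the unit interval\<close>

text \<open>
  The endpoints are excluded so that identities on \<open>(0, 1)\<close> hold almost everywhere without
  special cases at \<open>0\<close>, where the logarithm has its default value; the measure is the same as on the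
  closed interval.
\<close>

definition unif :: "real measure" where
  "unif = density lborel (indicator {0<..<1})"

lemma sets_unif [simp, measurable_cong]: "sets unif = sets borel"
  by (simp add: unif_def)

lemma space_unif [simp]: "space unif = UNIV"
  by (simp add: unif_def)

interpretation unif: prob_space unif
  by standard (simp add: unif_def emeasure_density)

lemma measure_unif_UNIV [simp]: "measure unif UNIV = 1"
  using unif.prob_space by simp

lemma AE_unif: "AE x in unif. 0 < x \<and> x < 1"
  unfolding unif_def by (subst AE_density) (auto simp: indicator_def split: if_splits)

lemma integral_unif_cong:
  assumes "f \<in> borel_measurable borel" "g \<in> borel_measurable borel"
    and "\<And>x. 0 < x \<Longrightarrow> x < 1 \<Longrightarrow> f x = g x"
  shows "integral\<^sup>L unif f = (integral\<^sup>L unif g :: real)"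
  using assms AE_unif by (intro integral_cong_AE) (auto simp: measurable_def)

text \<open>
  The integrands below are bounded functions on a subinterval, cut off by indicators, whose
  antiderivatives need only be continuous at the end points; this form covers \<open>t * ln t\<close> at \<open>0\<close>.
\<close>

lemma integral_unif_FTC:
  fixes F f g :: "real \<Rightarrow> real"
  assumes ab: "0 \<le> a" "a \<le> b" "b \<le> 1"
    and [measurable]: "g \<in> borel_measurable borel"
    and cont: "continuous_on {a..b} F"
    and deriv: "\<And>x. a < x \<Longrightarrow> x < b \<Longrightarrow> (F has_real_derivative f x) (at x)"
    and eq: "\<And>x. a < x \<Longrightarrow> x < b \<Longrightarrow> g x = f x"
    and bound: "\<And>x. a < x \<Longrightarrow> x < b \<Longrightarrow> \<bar>f x\<bar> \<le> B"
    and off: "\<And>x. 0 < x \<Longrightarrow> x < 1 \<Longrightarrow> \<not> (a < x \<and> x < b) \<Longrightarrow> g x = 0"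
  shows "integral\<^sup>L unif g = F b - F a"
proof -
  have "integral\<^sup>L unif g = (\<integral>x. indicator {0<..<1} x *\<^sub>R g x \<partial>lborel)"
    unfolding unif_def by (subst integral_density[symmetric]) (auto simp: ennreal_indicator)
  also have "\<dots> = (LINT x:{a<..<b}|lborel. g x)"
    unfolding set_lebesgue_integral_def
    using ab off by (intro Bochner_Integration.integral_cong) (auto simp: indicator_def)
  also have "\<dots> = integral {a<..<b} g"
  proof (rule set_borel_integral_eq_integral(2))
    show "set_integrable lborel {a<..<b} g"
      unfolding set_integrable_def
    proof (rule Bochner_Integration.integrable_bound)
      show "integrable lborel (\<lambda>x. indicator {a<..<b} x *\<^sub>R B)"
        using ab by (intro integrable_scaleR_left integrable_real_indicator) auto
      show "AE x in lborel. norm (indicator {a<..<b} x *\<^sub>R g x) \<le> norm (indicator {a<..<b} x *\<^sub>R B)"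
        using eq bound by (intro AE_I2) (force simp: indicator_def)
    qed simp
  qed
  also have "\<dots> = integral {a<..<b} f"
    by (intro Henstock_Kurzweil_Integration.integral_cong) (auto simp: eq)
  also have "\<dots> = integral {a..b} f"
    by (simp add: integral_open_interval_real)
  also have "\<dots> = F b - F a"
    by (intro integral_unique fundamental_theorem_of_calculus_interior ab cont)
       (auto intro!: deriv simp flip: has_real_derivative_iff_has_vector_derivative)
  finally show ?thesis .
qed

lemma integral_unif_less: "0 \<le> t \<Longrightarrow> t \<le> 1 \<Longrightarrow> (\<integral>x. of_bool (x < t) \<partial>unif) = (t :: real)"
  by (subst integral_unif_FTC[where a = 0 and b = t and F = "\<lambda>x. x" and f = "\<lambda>_. 1" and B = 1])
     (auto intro!: derivative_eq_intros continuous_intros)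

lemma integral_unif_greater: "0 \<le> t \<Longrightarrow> t \<le> 1 \<Longrightarrow> (\<integral>x. of_bool (t < x) \<partial>unif) = (1 - t :: real)"
  by (subst integral_unif_FTC[where a = t and b = 1 and F = "\<lambda>x. x" and f = "\<lambda>_. 1" and B = 1])
     (auto intro!: derivative_eq_intros continuous_intros)

lemma integral_unif_ratio:
  "0 < a \<Longrightarrow> a < b \<Longrightarrow> (\<integral>x. of_bool (x * b < a) \<partial>unif) = (a / b :: real)"
  by (subst integral_unif_FTC[where a = 0 and b = "a / b" and F = "\<lambda>x. x" and f = "\<lambda>_. 1" and B = 1])
     (auto intro!: derivative_eq_intros continuous_intros simp: field_simps)

text \<open>
  Projections of a kernel of degree \<open>4\<close> integrate out three arguments. The order of the iterated
  integrals is free, so that it can be chosen such that each single integral is elementary.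
\<close>

lemma integral_PiM_triple:
  fixes f :: "('i \<Rightarrow> real) \<Rightarrow> real"
  assumes ijk: "i \<noteq> j" "i \<noteq> k" "j \<noteq> k"
    and [measurable]: "f \<in> borel_measurable (PiM {k, j, i} (\<lambda>_. unif))"
    and bound: "\<And>y. \<bar>f y\<bar> \<le> B"
  shows "(\<integral>y. f y \<partial>PiM {k, j, i} (\<lambda>_. unif))
    = (\<integral>u. \<integral>v. \<integral>w. f ((\<lambda>_. undefined)(i := u, j := v, k := w)) \<partial>unif \<partial>unif \<partial>unif)"
proof -
  interpret P: product_prob_space "\<lambda>_. unif" UNIV by standard
  have p: "prob_space (PiM K (\<lambda>_. unif))" for K :: "'i set"
    by (intro prob_space_PiM unif.prob_space_axioms)
  have int: "integrable (PiM K (\<lambda>_. unif)) g"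
    if "g \<in> borel_measurable (PiM K (\<lambda>_. unif))" "\<And>y. \<bar>g y\<bar> \<le> B" for K :: "'i set" and g
  proof -
    interpret prob_space "PiM K (\<lambda>_. unif)" by (rule p)
    show ?thesis using that by (intro integrable_const_bound[of _ B]) auto
  qed
  have bd: "\<bar>\<integral>x. g x \<partial>unif\<bar> \<le> B" if "\<And>x. \<bar>g x\<bar> \<le> B" for g :: "real \<Rightarrow> real"
  proof (cases "integrable unif g")
    case True
    have "\<bar>\<integral>x. g x \<partial>unif\<bar> \<le> (\<integral>x. \<bar>g x\<bar> \<partial>unif)" by (rule integral_abs_bound)
    also have "\<dots> \<le> (\<integral>x. B \<partial>unif)"
      using True that by (intro integral_mono) auto
    finally show ?thesis by simp
  next
    case False
    then show ?thesis
      using order.trans[OF abs_ge_zero that] by (simp add: not_integrable_integral_eq)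
  qed
  define g1 where "g1 y = (\<integral>w. f (y(k := w)) \<partial>unif)" for y
  define g2 where "g2 y = (\<integral>v. g1 (y(j := v)) \<partial>unif)" for y
  have upd[measurable]: "(\<lambda>(y, w). y(l := w)) \<in> PiM K (\<lambda>_. unif) \<Otimes>\<^sub>M unif \<rightarrow>\<^sub>M PiM (insert l K) (\<lambda>_. unif)"
    for K and l :: 'i
    using measurable_add_dim[of l K "\<lambda>_. unif"] by simp
  have m1[measurable]: "g1 \<in> borel_measurable (PiM {j, i} (\<lambda>_. unif))"
    using measurable_compose[OF upd[of k "{j, i}"], of f borel] 
    unfolding g1_def[abs_def] by (intro unif.borel_measurable_lebesgue_integral) (simp add: case_prod_unfold)
  have m2[measurable]: "g2 \<in> borel_measurable (PiM {i} (\<lambda>_. unif))"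
    using measurable_compose[OF upd[of j "{i}"], of g1 borel]
    unfolding g2_def[abs_def] by (intro unif.borel_measurable_lebesgue_integral) (simp add: case_prod_unfold)
  have b1: "\<bar>g1 y\<bar> \<le> B" for y unfolding g1_def by (rule bd) (rule bound)
  have b2: "\<bar>g2 y\<bar> \<le> B" for y unfolding g2_def by (rule bd) (rule b1)
  have "(\<integral>y. f y \<partial>PiM {k, j, i} (\<lambda>_. unif)) = (\<integral>y. g1 y \<partial>PiM {j, i} (\<lambda>_. unif))"
    unfolding g1_def using ijk by (intro P.product_integral_insert int bound) auto
  also have "\<dots> = (\<integral>y. g2 y \<partial>PiM {i} (\<lambda>_. unif))"
    unfolding g2_def using ijk by (intro P.product_integral_insert int b1) auto
  also have "\<dots> = (\<integral>y. \<integral>u. g2 (y(i := u)) \<partial>unif \<partial>PiM {} (\<lambda>_. unif))"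
    by (intro P.product_integral_insert int b2) auto
  also have "\<dots> = (\<integral>u. g2 ((\<lambda>_. undefined)(i := u)) \<partial>unif)"
    unfolding PiM_empty by (subst lebesgue_integral_count_space_finite) (auto simp: fun_upd_def)
  finally show ?thesis unfolding g2_def g1_def .
qed

section \<open>The kernel of the statistic and its projections\<close>

text \<open>
  In terms of the uniform variables, \<open>y 0 < y 1 < y 2\<close> are an ordered triple and \<open>y 0 / y 1\<close> is the
  transform of the ratio of its two largest Pareto observations. The condition is stated without a
  quotient.
\<close>

definition spacing_kernel :: "(nat \<Rightarrow> real) \<Rightarrow> real" where
  "spacing_kernel y = of_bool (y 0 < y 1 \<and> y 1 < y 2 \<and> y 3 * y 1 < y 0)"

text \<open>
  The kernel of the mean of the empirical distribution function over the sample, read as a function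
  of four arguments so that both parts of the statistic are summed over the same tuples.
\<close>

definition rank_kernel :: "(nat \<Rightarrow> real) \<Rightarrow> real" where
  "rank_kernel y = of_bool (y 3 < y 0)"

text \<open>
  Only one in six of the index tuples with distinct entries has its first three arguments in
  increasing order; the factor \<open>6\<close> compensates for this.
\<close>

definition I3_kernel :: "(nat \<Rightarrow> real) \<Rightarrow> real" where
  "I3_kernel y = 6 * spacing_kernel y - rank_kernel y"

lemma lessThan_4_minus:
  "{..<4} - {0::nat} = {3, 2, 1}" "{..<4} - {1::nat} = {3, 2, 0}"
  "{..<4} - {2::nat} = {3, 0, 1}" "{..<4} - {3::nat} = {0, 2, 1}"
  by auto

lemma kernel_measurable [measurable]:
  "spacing_kernel \<in> borel_measurable (PiM {..<4} (\<lambda>_. unif))"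
  "rank_kernel \<in> borel_measurable (PiM {..<4} (\<lambda>_. unif))"
  unfolding spacing_kernel_def[abs_def] rank_kernel_def[abs_def] by measurable

lemma upd_measurable_unif:
  assumes "k < (4::nat)" "f \<in> borel_measurable (PiM {..<4} (\<lambda>_. unif))"
  shows "(\<lambda>y. f (y(k := t))) \<in> borel_measurable (PiM ({..<4} - {k}) (\<lambda>_. unif))"
proof (rule measurable_compose[OF _ assms(2)])
  have "{..<4} = ({..<4} - {k}) \<union> {k}" using assms by auto
  then show "(\<lambda>y. y(k := t)) \<in> PiM ({..<4} - {k}) (\<lambda>_. unif) \<rightarrow>\<^sub>M PiM {..<4} (\<lambda>_. unif)"
    by (rule measurable_fun_upd) auto
qed

lemma kernel_bounds: "\<bar>spacing_kernel y\<bar> \<le> 1" "\<bar>rank_kernel y\<bar> \<le> 1"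
  by (auto simp: spacing_kernel_def rank_kernel_def)


lemma abs_mult_le_one: "0 \<le> x \<Longrightarrow> x \<le> 1 \<Longrightarrow> 0 \<le> y \<Longrightarrow> y \<le> 1 \<Longrightarrow> \<bar>x * y\<bar> \<le> (1 :: real)"
  by (simp add: mult_le_one)

context
  fixes t :: real
  assumes t: "0 < t" "t < 1"
begin

text \<open>
  The four conditional probabilities. In each of them the innermost integral runs over the
  argument that makes the ratio condition an interval; the others are integrals of powers and, at
  position \<open>0\<close>, of \<open>t / b\<close>, which brings in the logarithm.
\<close>

lemma spacing_proj_0:
  "(\<integral>y. spacing_kernel (y(0 := t)) \<partial>PiM ({..<4} - {0}) (\<lambda>_. unif)) = t * (t - 1 - ln t)"
proof -
  have "(\<integral>y. spacing_kernel (y(0 := t)) \<partial>PiM ({..<4} - {0}) (\<lambda>_. unif))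
      = (\<integral>b. \<integral>c. \<integral>z. of_bool (t < b \<and> b < c \<and> z * b < t) \<partial>unif \<partial>unif \<partial>unif)"
    using upd_measurable_unif[of 0 spacing_kernel t] unfolding lessThan_4_minus
    by (subst integral_PiM_triple[where B = 1]) (simp_all add: kernel_bounds spacing_kernel_def)
  also have "\<dots> = (\<integral>b. \<integral>c. of_bool (b < c) * (of_bool (t < b) * (t / b)) \<partial>unif \<partial>unif)"
  proof (intro integral_unif_cong)
    fix b c :: real
    show "(\<integral>z. of_bool (t < b \<and> b < c \<and> z * b < t) \<partial>unif) = of_bool (b < c) * (of_bool (t < b) * (t / b))"
      using integral_unif_ratio[of t b] t by (cases "t < b"; cases "b < c") auto
  qed measurable
  also have "\<dots> = (\<integral>b. (1 - b) * (of_bool (t < b) * (t / b)) \<partial>unif)"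
    by (intro integral_unif_cong) (simp_all add: integral_unif_greater)
  also have "\<dots> = t * (ln 1 - 1) - t * (ln t - t)"
  proof (rule integral_unif_FTC[where a = t and b = 1 and F = "\<lambda>x. t * (ln x - x)"
        and f = "\<lambda>b. (1 - b) * (t / b)" and B = 1])
    show "((\<lambda>x. t * (ln x - x)) has_real_derivative (1 - b) * (t / b)) (at b)" if "t < b" "b < 1" for b
      using that t by (auto intro!: derivative_eq_intros simp: field_simps)
    show "\<bar>(1 - b) * (t / b)\<bar> \<le> 1" if "t < b" "b < 1" for b
      using that t by (intro abs_mult_le_one) auto
  qed (use t in \<open>auto intro!: continuous_intros\<close>)
  finally show ?thesis by (simp add: algebra_simps)
qed

lemma spacing_proj_1:
  "(\<integral>y. spacing_kernel (y(1 := t)) \<partial>PiM ({..<4} - {1}) (\<lambda>_. unif)) = t * (1 - t) / 2"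
proof -
  have "(\<integral>y. spacing_kernel (y(1 := t)) \<partial>PiM ({..<4} - {1}) (\<lambda>_. unif))
      = (\<integral>a. \<integral>c. \<integral>z. of_bool (a < t \<and> t < c \<and> z * t < a) \<partial>unif \<partial>unif \<partial>unif)"
    using upd_measurable_unif[of 1 spacing_kernel t] unfolding lessThan_4_minus
    by (subst integral_PiM_triple[where B = 1]) (simp_all add: kernel_bounds spacing_kernel_def)
  also have "\<dots> = (\<integral>a. \<integral>c. of_bool (t < c) * (of_bool (a < t) * (a / t)) \<partial>unif \<partial>unif)"
  proof (intro integral_unif_cong)
    fix a c :: real assume "0 < a"
    then show "(\<integral>z. of_bool (a < t \<and> t < c \<and> z * t < a) \<partial>unif) = of_bool (t < c) * (of_bool (a < t) * (a / t))"
      using integral_unif_ratio[of a t] t by (cases "a < t"; cases "t < c") auto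
  qed measurable
  also have "\<dots> = (\<integral>a. (1 - t) * (of_bool (a < t) * (a / t)) \<partial>unif)"
    using t by (intro integral_unif_cong) (simp_all add: integral_unif_greater)
  also have "\<dots> = (1 - t) * (t\<^sup>2 / (2 * t)) - (1 - t) * (0\<^sup>2 / (2 * t))"
  proof (rule integral_unif_FTC[where a = 0 and b = t and F = "\<lambda>x. (1 - t) * (x\<^sup>2 / (2 * t))"
        and f = "\<lambda>a. (1 - t) * (a / t)" and B = 1])
    show "((\<lambda>x. (1 - t) * (x\<^sup>2 / (2 * t))) has_real_derivative (1 - t) * (a / t)) (at a)" if "0 < a" "a < t" for a
      using that t by (auto intro!: derivative_eq_intros simp: field_simps)
    show "\<bar>(1 - t) * (a / t)\<bar> \<le> 1" if "0 < a" "a < t" for a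
      using that t by (intro abs_mult_le_one) auto
  qed (use t in \<open>auto intro!: continuous_intros\<close>)
  finally show ?thesis using t by (simp add: field_simps power2_eq_square)
qed

lemma spacing_proj_2:
  "(\<integral>y. spacing_kernel (y(2 := t)) \<partial>PiM ({..<4} - {2}) (\<lambda>_. unif)) = t\<^sup>2 / 4"
proof -
  have "(\<integral>y. spacing_kernel (y(2 := t)) \<partial>PiM ({..<4} - {2}) (\<lambda>_. unif))
      = (\<integral>b. \<integral>a. \<integral>z. of_bool (a < b \<and> b < t \<and> z * b < a) \<partial>unif \<partial>unif \<partial>unif)"
    using upd_measurable_unif[of 2 spacing_kernel t] unfolding lessThan_4_minus
    by (subst integral_PiM_triple[where B = 1, of 1 0 3]) (simp_all add: kernel_bounds spacing_kernel_def insert_commute)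
  also have "\<dots> = (\<integral>b. \<integral>a. of_bool (b < t) * (of_bool (a < b) * (a / b)) \<partial>unif \<partial>unif)"
  proof (intro integral_unif_cong)
    fix a b :: real assume "0 < a" "0 < b"
    then show "(\<integral>z. of_bool (a < b \<and> b < t \<and> z * b < a) \<partial>unif) = of_bool (b < t) * (of_bool (a < b) * (a / b))"
      using integral_unif_ratio[of a b] by (cases "a < b"; cases "b < t") auto
  qed measurable
  also have "\<dots> = (\<integral>b. of_bool (b < t) * (b / 2) \<partial>unif)"
  proof (intro integral_unif_cong)
    fix b :: real assume b: "0 < b" "b < 1"
    have "(\<integral>a. of_bool (a < b) * (a / b) \<partial>unif) = b\<^sup>2 / (2 * b) - 0\<^sup>2 / (2 * b)"
    proof (rule integral_unif_FTC[where a = 0 and b = b and F = "\<lambda>x. x\<^sup>2 / (2 * b)" and f = "\<lambda>a. a / b" and B = 1])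
      show "((\<lambda>x. x\<^sup>2 / (2 * b)) has_real_derivative a / b) (at a)" for a
        using b by (auto intro!: derivative_eq_intros simp: field_simps)
    qed (use b in \<open>auto intro!: continuous_intros simp: field_simps\<close>)
    then show "(\<integral>a. of_bool (b < t) * (of_bool (a < b) * (a / b)) \<partial>unif) = of_bool (b < t) * (b / 2)"
      using b by (simp add: power2_eq_square)
  qed measurable
  also have "\<dots> = t\<^sup>2 / 4 - 0\<^sup>2 / 4"
  proof (rule integral_unif_FTC[where a = 0 and b = t and F = "\<lambda>x. x\<^sup>2 / 4" and f = "\<lambda>b. b / 2" and B = 1])
    show "((\<lambda>x. x\<^sup>2 / 4) has_real_derivative b / 2) (at b)" for b :: real
      by (auto intro!: derivative_eq_intros)
  qed (use t in \<open>auto intro!: continuous_intros\<close>)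
  finally show ?thesis by simp
qed

lemma spacing_proj_3:
  "(\<integral>y. spacing_kernel (y(3 := t)) \<partial>PiM ({..<4} - {3}) (\<lambda>_. unif)) = (1 - t) / 6"
proof -
  have "(\<integral>y. spacing_kernel (y(3 := t)) \<partial>PiM ({..<4} - {3}) (\<lambda>_. unif))
      = (\<integral>b. \<integral>c. \<integral>a. of_bool (a < b \<and> b < c \<and> t * b < a) \<partial>unif \<partial>unif \<partial>unif)"
    using upd_measurable_unif[of 3 spacing_kernel t] unfolding lessThan_4_minus
    by (subst integral_PiM_triple[where B = 1]) (simp_all add: kernel_bounds spacing_kernel_def)
  also have "\<dots> = (\<integral>b. \<integral>c. of_bool (b < c) * (b - t * b) \<partial>unif \<partial>unif)"
  proof (intro integral_unif_cong)
    fix b c :: real assume b: "0 < b" "b < 1"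
    have "t * b \<le> b" using t b by simp
    then have "(\<integral>a. of_bool (a < b \<and> t * b < a) \<partial>unif) = b - t * b"
      using b t by (intro integral_unif_FTC[where F = "\<lambda>x. x" and f = "\<lambda>_. 1" and B = 1])
        (auto intro!: derivative_eq_intros continuous_intros)
    then show "(\<integral>a. of_bool (a < b \<and> b < c \<and> t * b < a) \<partial>unif) = of_bool (b < c) * (b - t * b)"
      by (cases "b < c") auto
  qed measurable
  also have "\<dots> = (\<integral>b. (1 - b) * (b - t * b) \<partial>unif)"
    by (intro integral_unif_cong) (simp_all add: integral_unif_greater)
  also have "\<dots> = (1 - t) * (1\<^sup>2 / 2 - 1 ^ 3 / 3) - (1 - t) * (0\<^sup>2 / 2 - 0 ^ 3 / 3)"
  proof (rule integral_unif_FTC[where a = 0 and b = 1 and F = "\<lambda>x. (1 - t) * (x\<^sup>2 / 2 - x ^ 3 / 3)"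
        and f = "\<lambda>b. (1 - b) * (b - t * b)" and B = 1])
    show "((\<lambda>x. (1 - t) * (x\<^sup>2 / 2 - x ^ 3 / 3)) has_real_derivative (1 - b) * (b - t * b)) (at b)" for b :: real
    proof -
      have "((\<lambda>x. (1 - t) * (x\<^sup>2 / 2 - x ^ 3 / 3)) has_real_derivative (1 - t) * (b - b\<^sup>2)) (at b)"
        by (auto intro!: derivative_eq_intros)
      also have "(1 - t) * (b - b\<^sup>2) = (1 - b) * (b - t * b)" by algebra
      finally show ?thesis .
    qed
    show "\<bar>(1 - b) * (b - t * b)\<bar> \<le> 1" if "0 < b" "b < 1" for b
    proof -
      have "b - t * b = (1 - t) * b" by (simp add: algebra_simps)
      moreover have "0 \<le> (1 - t) * b" "(1 - t) * b \<le> 1"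
        using that t by (auto intro!: mult_le_one)
      ultimately show ?thesis using that by (intro abs_mult_le_one) auto
    qed
  qed (auto intro!: continuous_intros)
  finally show ?thesis by simp
qed

lemma rank_proj:
  "(\<integral>y. rank_kernel (y(0 := t)) \<partial>PiM ({..<4} - {0}) (\<lambda>_. unif)) = t"
  "(\<integral>y. rank_kernel (y(1 := t)) \<partial>PiM ({..<4} - {1}) (\<lambda>_. unif)) = 1 / 2"
  "(\<integral>y. rank_kernel (y(2 := t)) \<partial>PiM ({..<4} - {2}) (\<lambda>_. unif)) = 1 / 2"
  "(\<integral>y. rank_kernel (y(3 := t)) \<partial>PiM ({..<4} - {3}) (\<lambda>_. unif)) = 1 - t"
proof -
  have half: "(\<integral>a. \<integral>z. of_bool (z < a) \<partial>unif \<partial>unif) = (1 / 2 :: real)"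
  proof -
    have "(\<integral>a. \<integral>z. of_bool (z < a) \<partial>unif \<partial>unif) = (\<integral>a. a \<partial>unif)"
      by (intro integral_unif_cong) (simp_all add: integral_unif_less)
    also have "\<dots> = (1::real)\<^sup>2 / 2 - 0\<^sup>2 / 2"
      by (rule integral_unif_FTC[where a = 0 and b = 1 and F = "\<lambda>x. x\<^sup>2 / 2" and f = "\<lambda>x. x" and B = 1])
         (auto intro!: derivative_eq_intros continuous_intros)
    finally show ?thesis by simp
  qed
  show "(\<integral>y. rank_kernel (y(0 := t)) \<partial>PiM ({..<4} - {0}) (\<lambda>_. unif)) = t"
    using upd_measurable_unif[of 0 rank_kernel t] t unfolding lessThan_4_minus
    by (subst integral_PiM_triple[where B = 1]) (simp_all add: kernel_bounds rank_kernel_def integral_unif_less)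
  show "(\<integral>y. rank_kernel (y(1 := t)) \<partial>PiM ({..<4} - {1}) (\<lambda>_. unif)) = 1 / 2"
    using upd_measurable_unif[of 1 rank_kernel t] half unfolding lessThan_4_minus
    by (subst integral_PiM_triple[where B = 1]) (simp_all add: kernel_bounds rank_kernel_def)
  show "(\<integral>y. rank_kernel (y(2 := t)) \<partial>PiM ({..<4} - {2}) (\<lambda>_. unif)) = 1 / 2"
    using upd_measurable_unif[of 2 rank_kernel t] half unfolding lessThan_4_minus
    by (subst integral_PiM_triple[where B = 1]) (simp_all add: kernel_bounds rank_kernel_def)
  show "(\<integral>y. rank_kernel (y(3 := t)) \<partial>PiM ({..<4} - {3}) (\<lambda>_. unif)) = 1 - t"
    using upd_measurable_unif[of 3 rank_kernel t] t unfolding lessThan_4_minus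
    by (subst integral_PiM_triple[where B = 1]) (simp_all add: kernel_bounds rank_kernel_def integral_unif_greater)
qed

end

text \<open>
  The influence function of the kernel on the unit interval.
\<close>

definition pareto_influence :: "real \<Rightarrow> real" where
  "pareto_influence t = 9 / 2 * t\<^sup>2 - 4 * t - 1 - 6 * t * ln t"

text \<open>
  Integration by an explicit antiderivative. The bound on the integrand, which secures Lebesgue
  integrability, is a hypothesis because the influence function of a bounded kernel is
  bounded anyway.
\<close>

lemma integral_pareto_influence_squared:
  assumes bound: "\<And>t. 0 < t \<Longrightarrow> t < 1 \<Longrightarrow> \<bar>pareto_influence t\<bar> \<le> B"
  shows "(\<integral>t. (pareto_influence t)\<^sup>2 \<partial>unif) = 11 / 120"
proof -
  define F where "F t = 12 * t ^ 3 * (ln t)\<^sup>2 - 8 * t ^ 3 * ln t + 8 / 3 * t ^ 3 + 6 * t\<^sup>2 * ln t - 3 * t\<^sup>2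
      + 16 * t ^ 3 * ln t - 16 / 3 * t ^ 3 - 27 / 2 * t ^ 4 * ln t + 27 / 8 * t ^ 4
      + t + 4 * t\<^sup>2 + 7 / 3 * t ^ 3 - 9 * t ^ 4 + 81 / 20 * t ^ 5" for t :: real
  have "(\<integral>t. (pareto_influence t)\<^sup>2 \<partial>unif) = F 1 - F 0"
  proof (rule integral_unif_FTC[where a = 0 and b = 1 and f = "\<lambda>t. (pareto_influence t)\<^sup>2" and B = "B\<^sup>2"])
    show "(\<lambda>t. (pareto_influence t)\<^sup>2) \<in> borel_measurable borel"
      unfolding pareto_influence_def by measurable
    show "(F has_real_derivative (pareto_influence t)\<^sup>2) (at t)" if "0 < t" "t < 1" for t
      unfolding F_def[abs_def] pareto_influence_def using that
      by (auto intro!: derivative_eq_intros simp: field_simps power2_eq_square power3_eq_cube power4_eq_xxxx)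
    show "\<bar>(pareto_influence t)\<^sup>2\<bar> \<le> B\<^sup>2" if "0 < t" "t < 1" for t
      using power_mono[OF bound[OF that], of 2] by simp
    have "(F \<longlongrightarrow> F 0) (at_right 0)"
      unfolding F_def by simp real_asymp
    then have "continuous (at 0 within {0..1}) F"
      by (simp add: continuous_within at_within_Icc_at_right)
    moreover have "isCont F t" if "0 < t" for t
      unfolding F_def[abs_def] using that by (auto intro!: continuous_intros)
    ultimately show "continuous_on {0..1} F"
      unfolding continuous_on_eq_continuous_within
      by (metis atLeastAtMost_iff continuous_at_imp_continuous_at_within less_eq_real_def)
  qed auto
  then show ?thesis by (simp add: F_def)
qed

lemma I3_kernel_proj:
  assumes k: "k < 4"
  shows "(\<integral>y. I3_kernel (y(k := t)) \<partial>PiM ({..<4} - {k}) (\<lambda>_. unif))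
    = 6 * (\<integral>y. spacing_kernel (y(k := t)) \<partial>PiM ({..<4} - {k}) (\<lambda>_. unif))
      - (\<integral>y. rank_kernel (y(k := t)) \<partial>PiM ({..<4} - {k}) (\<lambda>_. unif))"
proof -
  interpret P: prob_space "PiM ({..<4} - {k}) (\<lambda>_. unif)"
    by (intro prob_space_PiM unif.prob_space_axioms)
  have "integrable (PiM ({..<4} - {k}) (\<lambda>_. unif)) (\<lambda>y. spacing_kernel (y(k := t)))"
    "integrable (PiM ({..<4} - {k}) (\<lambda>_. unif)) (\<lambda>y. rank_kernel (y(k := t)))"
    by (intro P.integrable_const_bound[of _ 1] upd_measurable_unif k kernel_measurable; simp add: kernel_bounds)+
  then show ?thesis
    unfolding I3_kernel_def by simp
qed

text \<open>
  The projection on the last argument vanishes: the ratio of the two largest of three Pareto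
  variables has the Pareto law itself. This also forces the mean of the kernel to be \<open>0\<close>.
\<close>

lemma I3_kernel_proj_values:
  assumes t: "0 < t" "t < 1"
  shows "(\<integral>y. I3_kernel (y(0 := t)) \<partial>PiM ({..<4} - {0}) (\<lambda>_. unif)) = 6 * (t * (t - 1 - ln t)) - t"
    "(\<integral>y. I3_kernel (y(1 := t)) \<partial>PiM ({..<4} - {1}) (\<lambda>_. unif)) = 3 * t * (1 - t) - 1 / 2"
    "(\<integral>y. I3_kernel (y(2 := t)) \<partial>PiM ({..<4} - {2}) (\<lambda>_. unif)) = 3 / 2 * t\<^sup>2 - 1 / 2"
    "(\<integral>y. I3_kernel (y(3 := t)) \<partial>PiM ({..<4} - {3}) (\<lambda>_. unif)) = 0"
proof -
  show "(\<integral>y. I3_kernel (y(0 := t)) \<partial>PiM ({..<4} - {0}) (\<lambda>_. unif)) = 6 * (t * (t - 1 - ln t)) - t"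
    using I3_kernel_proj[of 0 t] spacing_proj_0[OF t] rank_proj(1)[OF t] by simp
  show "(\<integral>y. I3_kernel (y(1 := t)) \<partial>PiM ({..<4} - {1}) (\<lambda>_. unif)) = 3 * t * (1 - t) - 1 / 2"
    using I3_kernel_proj[of 1 t] spacing_proj_1[OF t] rank_proj(2)[OF t] by simp
  show "(\<integral>y. I3_kernel (y(2 := t)) \<partial>PiM ({..<4} - {2}) (\<lambda>_. unif)) = 3 / 2 * t\<^sup>2 - 1 / 2"
    using I3_kernel_proj[of 2 t] spacing_proj_2[OF t] rank_proj(3)[OF t] by simp
  show "(\<integral>y. I3_kernel (y(3 := t)) \<partial>PiM ({..<4} - {3}) (\<lambda>_. unif)) = 0"
    using I3_kernel_proj[of 3 t] spacing_proj_3[OF t] rank_proj(4)[OF t] by simp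
qed

section \<open>The statistic as a V-statistic\<close>

text \<open>
  Every set of three points with distinct values of \<open>x\<close> has exactly one increasing enumeration.
  With \<open>x\<close> the identity this describes the triples of increasing indices, with \<open>x\<close>
  the sample it describes the triples of increasing observations.
\<close>

lemma sum_ordered_triples:
  fixes x :: "'i \<Rightarrow> 'l :: linorder"
  assumes inj: "inj_on x S"
  shows "(\<Sum>(a, b, c)\<in>{(a, b, c). a \<in> S \<and> b \<in> S \<and> c \<in> S \<and> x a < x b \<and> x b < x c}. f {a, b, c})
    = (\<Sum>A\<in>{A. A \<subseteq> S \<and> card A = 3}. f A)"
proof -
  let ?D = "{(a, b, c). a \<in> S \<and> b \<in> S \<and> c \<in> S \<and> x a < x b \<and> x b < x c}"
  let ?g = "\<lambda>(a, b, c). {a, b, c}"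
  have "bij_betw ?g ?D {A. A \<subseteq> S \<and> card A = 3}"
    unfolding bij_betw_def
  proof
    show "inj_on ?g ?D"
    proof (rule inj_onI)
      fix t t' assume t: "t \<in> ?D" "t' \<in> ?D" and e: "?g t = ?g t'"
      obtain a b c a' b' c' where tt: "t = (a, b, c)" "t' = (a', b', c')" by (metis prod_cases3)
      have S: "a \<in> S" "b \<in> S" "c \<in> S" "a' \<in> S" "b' \<in> S" "c' \<in> S"
        and o: "x a < x b" "x b < x c" "x a' < x b'" "x b' < x c'"
        using t unfolding tt by auto
      have eq: "{a, b, c} = {a', b', c'}" using e unfolding tt by simp
      have "x a \<le> x a'" "x c' \<le> x c"
        using o eq[THEN equalityD2] by (auto dest: less_imp_le less_trans)
      moreover have "x a' \<le> x a" "x c \<le> x c'"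
        using o eq[THEN equalityD1] by (auto dest: less_imp_le less_trans)
      ultimately have "x a = x a'" "x c = x c'" by auto
      then have ac: "a = a'" "c = c'" using inj S by (auto dest: inj_onD)
      have "b \<in> {a', b', c'}" using eq by blast
      then have "b = b'" using o ac by auto
      then show "t = t'" using ac tt by simp
    qed
    show "?g ` ?D = {A. A \<subseteq> S \<and> card A = 3}"
    proof (intro equalityI subsetI)
      fix A assume "A \<in> ?g ` ?D"
      then obtain a b c where "a \<in> S" "b \<in> S" "c \<in> S" "x a < x b" "x b < x c" "A = {a, b, c}" by auto
      moreover from this have "a \<noteq> b" "b \<noteq> c" "a \<noteq> c" by auto
      ultimately show "A \<in> {A. A \<subseteq> S \<and> card A = 3}" by simp
    next
      fix A assume "A \<in> {A. A \<subseteq> S \<and> card A = 3}"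
      then obtain u v w where A: "A = {u, v, w}" "u \<in> S" "v \<in> S" "w \<in> S"
        and d: "u \<noteq> v" "u \<noteq> w" "v \<noteq> w"
        by (auto simp: card_3_iff)
      have mem: "A \<in> ?g ` ?D" if "a \<in> S" "b \<in> S" "c \<in> S" "x a < x b" "x b < x c" "A = {a, b, c}" for a b c
        using that by (intro image_eqI[of _ _ "(a, b, c)"]) auto
      have "x u \<noteq> x v" "x u \<noteq> x w" "x v \<noteq> x w"
        using inj A d by (auto dest: inj_onD)
      then consider "x u < x v" "x v < x w" | "x u < x w" "x w < x v" | "x v < x u" "x u < x w"
        | "x v < x w" "x w < x u" | "x w < x u" "x u < x v" | "x w < x v" "x v < x u"
        by (meson linorder_neqE)
      then show "A \<in> ?g ` ?D"
        by cases (use A in \<open>auto intro!: mem\<close>)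
    qed
  qed
  from sum.reindex_bij_betw[OF this, of f] show ?thesis
    by (simp add: case_prod_unfold)
qed

lemma order_stat_triple:
  fixes x :: "nat \<Rightarrow> real"
  assumes "x c < x b" "x b < x a"
  shows "order_stat 3 {a, b, c} x = x a" "order_stat 2 {a, b, c} x = x b"
proof -
  have d: "a \<noteq> b" "b \<noteq> c" "a \<noteq> c" using assms by auto
  have "sort (map x (sorted_list_of_set {a, b, c})) = [x c, x b, x a]"
    by (rule properties_for_sort) (use assms d in \<open>auto simp flip: image_mset_mset_set\<close>)
  then show "order_stat 3 {a, b, c} x = x a" "order_stat 2 {a, b, c} x = x b"
    by (simp_all add: order_stat_def)
qed

lemma sum_PiE_4:
  fixes g :: "'b \<Rightarrow> 'b \<Rightarrow> 'b \<Rightarrow> 'b \<Rightarrow> real"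
  shows "(\<Sum>p\<in>{..<4::nat} \<rightarrow>\<^sub>E T. g (p 0) (p 1) (p 2) (p 3)) = (\<Sum>(a, b, c)\<in>T \<times> T \<times> T. \<Sum>l\<in>T. g a b c l)"
proof -
  let ?i = "\<lambda>((a :: 'b, b, c), l). \<lambda>k\<in>{..<4::nat}. if k = 0 then a else if k = 1 then b else if k = 2 then c else l"
  have "(\<Sum>p\<in>{..<4::nat} \<rightarrow>\<^sub>E T. g (p 0) (p 1) (p 2) (p 3)) = (\<Sum>((a, b, c), l)\<in>(T \<times> T \<times> T) \<times> T. g a b c l)"
  proof (rule sum.reindex_bij_witness[of _ ?i "\<lambda>p :: nat \<Rightarrow> 'b. ((p 0, p 1, p 2), p 3)"])
    fix p :: "nat \<Rightarrow> 'b" assume p: "p \<in> {..<4} \<rightarrow>\<^sub>E T"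
    have "p k = (\<lambda>k\<in>{..<4}. if k = 0 then p 0 else if k = 1 then p 1 else if k = 2 then p 2 else p 3) k" for k
    proof (cases "k < 4")
      case True
      then have "k = 0 \<or> k = 1 \<or> k = 2 \<or> k = 3" by auto
      then show ?thesis by auto
    next
      case False
      then show ?thesis using PiE_arb[OF p, of k] by simp
    qed
    from this[symmetric] show "?i ((p 0, p 1, p 2), p 3) = p"
      unfolding prod.case by (rule ext)
    show "((p 0, p 1, p 2), p 3) \<in> (T \<times> T \<times> T) \<times> T"
      using PiE_mem[OF p] by simp
  qed (auto split: if_splits)
  then show ?thesis
    by (simp add: sum.cartesian_product case_prod_unfold)
qed

text \<open>
  Without ties, the spacing kernel summed over all tuples counts precisely the pairs of an unordered
  triple and a sample point that occur in the statistic. The statistic and the V-statistic then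
  differ only in the normalisation, \<open>6 / (n * (n * (n - 1) * (n - 2)))\<close> against \<open>6 / n ^ 4\<close>, of a
  sum that is at most \<open>n * (n choose 3)\<close>.
\<close>

lemma I3_close_to_vstatistic:
  fixes x u :: "nat \<Rightarrow> real"
  assumes n: "n \<ge> 3" and lam: "lam > 0"
    and gt: "\<And>i. i \<in> {1..n} \<Longrightarrow> x i > 1" and inj: "inj_on x {1..n}"
    and u: "\<And>i. i \<in> {1..n} \<Longrightarrow> u i = x i powr (- lam)"
  shows "\<bar>I3 n x - (\<Sum>p\<in>{..<4} \<rightarrow>\<^sub>E {1..n}. I3_kernel (\<lambda>k\<in>{..<4}. u (p k))) / real n ^ 4\<bar> \<le> 3 / n"
proof -
  let ?T = "{1..n}"
  let ?C = "real (n choose 3)"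
  let ?D = "{(a, b, c). a \<in> ?T \<and> b \<in> ?T \<and> c \<in> ?T \<and> u a < u b \<and> u b < u c}"
  have upos: "u i > 0" if "i \<in> ?T" for i using u[OF that] gt[OF that] by simp
  have powr_less: "p powr (- lam) < q powr (- lam) \<longleftrightarrow> q < p" if "p > 0" "q > 0" for p q
    using powr_less_mono2_neg[of "- lam" p q] powr_less_mono2_neg[of "- lam" q p] that lam
    by (cases p q rule: linorder_cases) auto
  have uless: "u i < u j \<longleftrightarrow> x j < x i" if "i \<in> ?T" "j \<in> ?T" for i j
    unfolding u[OF that(1)] u[OF that(2)] using gt[OF that(1)] gt[OF that(2)] by (intro powr_less) auto
  have uratio: "x a / x b < x l \<longleftrightarrow> u l * u b < u a" if "a \<in> ?T" "b \<in> ?T" "l \<in> ?T" for a b l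
  proof -
    have pos: "x a > 0" "x b > 0" "x l > 0" using gt that by (auto intro: less_trans[OF zero_less_one])
    have "u l * u b < u a \<longleftrightarrow> (x l * x b) powr (- lam) < x a powr (- lam)"
      using pos that by (simp add: u powr_mult)
    also have "\<dots> \<longleftrightarrow> x a < x l * x b"
      using pos by (intro powr_less) auto
    also have "\<dots> \<longleftrightarrow> x a / x b < x l"
      using pos by (simp add: field_simps)
    finally show ?thesis by simp
  qed
  have injid: "inj_on (\<lambda>i. i) ?T" by simp
  have inju: "inj_on u ?T"
  proof (rule inj_onI)
    fix i j assume ij: "i \<in> ?T" "j \<in> ?T" "u i = u j"
    then have "x i = x j" using uless[OF ij(1,2)] uless[OF ij(2,1)] by auto
    then show "i = j" using inj ij by (auto dest: inj_onD)
  qed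
  have finD: "finite ?D"
    by (rule finite_subset[of _ "?T \<times> ?T \<times> ?T"]) auto
  \<comment> \<open>\<open>A\<close> counts the events in the ratio part of the statistic, \<open>R\<close> those in the rank part.\<close>
  define A where "A = (\<Sum>(a, b, c)\<in>?D. \<Sum>l\<in>?T. of_bool (u l * u b < u a) :: real)"
  define R where "R = (\<Sum>i\<in>?T. \<Sum>j\<in>?T. of_bool (x j < x i) :: real)"
  have ratio: "ratio_df n x t = inverse ?C * (\<Sum>(a, b, c)\<in>?D. of_bool (x a / x b < t))" for t
  proof -
    let ?f = "\<lambda>A. of_bool (order_stat 3 A x / order_stat 2 A x < t) :: real"
    have incr: "{(i1, i2, i3). 1 \<le> i1 \<and> i1 < i2 \<and> i2 < i3 \<and> i3 \<le> n}
        = {(a, b, c). a \<in> ?T \<and> b \<in> ?T \<and> c \<in> ?T \<and> a < b \<and> b < c}" by auto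
    have "(\<Sum>(i1, i2, i3)\<in>{(i1, i2, i3). 1 \<le> i1 \<and> i1 < i2 \<and> i2 < i3 \<and> i3 \<le> n}. ?f {i1, i2, i3})
        = (\<Sum>(a, b, c)\<in>?D. ?f {a, b, c})"
      unfolding incr using sum_ordered_triples[OF injid, of ?f] sum_ordered_triples[OF inju, of ?f] by simp
    also have "\<dots> = (\<Sum>(a, b, c)\<in>?D. of_bool (x a / x b < t))"
      by (intro sum.cong refl) (auto simp: order_stat_triple uless)
    finally show ?thesis by (simp add: ratio_df_def)
  qed
  have I3: "I3 n x = A / (real n * ?C) - R / (real n)\<^sup>2"
  proof -
    have "I3 n x = inverse (real n) * (\<Sum>i = 1..n. ratio_df n x (x i) - emp_df n x (x i))"
      using n gt by (intro I3_eq_sum) (auto intro: less_imp_le)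
    also have "(\<Sum>i = 1..n. ratio_df n x (x i)) = inverse ?C * A"
    proof -
      have "(\<Sum>i = 1..n. ratio_df n x (x i)) = inverse ?C * (\<Sum>(a, b, c)\<in>?D. \<Sum>l\<in>?T. of_bool (x a / x b < x l))"
        unfolding ratio case_prod_unfold by (subst sum.swap) (simp add: sum_distrib_left)
      also have "(\<Sum>(a, b, c)\<in>?D. \<Sum>l\<in>?T. of_bool (x a / x b < x l)) = A"
        unfolding A_def by (rule sum.cong[OF refl]) (auto simp: uratio simp del: sum_of_bool_eq intro!: sum.cong)
      finally show ?thesis .
    qed
    then have "(\<Sum>i = 1..n. ratio_df n x (x i) - emp_df n x (x i)) = inverse ?C * A - inverse (real n) * R"
      by (simp add: sum_subtractf emp_df_def R_def sum_distrib_left)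
    finally show ?thesis
      by (simp add: divide_inverse inverse_mult_distrib power2_eq_square right_diff_distrib mult_ac)
  qed
  have V: "(\<Sum>p\<in>{..<4} \<rightarrow>\<^sub>E ?T. I3_kernel (\<lambda>k\<in>{..<4}. u (p k))) = 6 * A - (real n)\<^sup>2 * R"
  proof -
    have "(\<Sum>p\<in>{..<4::nat} \<rightarrow>\<^sub>E ?T. spacing_kernel (\<lambda>k\<in>{..<4}. u (p k)))
        = (\<Sum>(a, b, c)\<in>?T \<times> ?T \<times> ?T. \<Sum>l\<in>?T. of_bool (u a < u b \<and> u b < u c \<and> u l * u b < u a))"
      using sum_PiE_4[of "\<lambda>a b c l. of_bool (u a < u b \<and> u b < u c \<and> u l * u b < u a)" ?T]
      by (simp add: spacing_kernel_def)
    also have "\<dots> = A"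
      unfolding A_def by (rule sum.mono_neutral_cong_right) auto
    finally have 1: "(\<Sum>p\<in>{..<4::nat} \<rightarrow>\<^sub>E ?T. spacing_kernel (\<lambda>k\<in>{..<4}. u (p k))) = A" .
    have "(\<Sum>p\<in>{..<4::nat} \<rightarrow>\<^sub>E ?T. rank_kernel (\<lambda>k\<in>{..<4}. u (p k)))
        = (\<Sum>(a, b, c)\<in>?T \<times> ?T \<times> ?T. \<Sum>l\<in>?T. of_bool (u l < u a))"
      using sum_PiE_4[of "\<lambda>a b c l. of_bool (u l < u a)" ?T] by (simp add: rank_kernel_def)
    also have "\<dots> = (\<Sum>a\<in>?T. (real n)\<^sup>2 * (\<Sum>l\<in>?T. of_bool (u l < u a)))"
      by (simp add: sum.cartesian_product[symmetric] power2_eq_square mult.assoc del: sum_of_bool_eq)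
    also have "\<dots> = (real n)\<^sup>2 * (\<Sum>a\<in>?T. \<Sum>l\<in>?T. of_bool (x a < x l))"
      unfolding sum_distrib_left[symmetric] by (intro arg_cong2[where f = times] sum.cong refl) (simp add: uless)
    also have "\<dots> = (real n)\<^sup>2 * R"
      unfolding R_def by (subst sum.swap) (rule refl)
    finally have 2: "(\<Sum>p\<in>{..<4::nat} \<rightarrow>\<^sub>E ?T. rank_kernel (\<lambda>k\<in>{..<4}. u (p k))) = (real n)\<^sup>2 * R" .
    show ?thesis
      unfolding I3_kernel_def sum_subtractf sum_distrib_left[symmetric] 1 2 ..
  qed
  have cardD: "real (card ?D) = ?C"
    using sum_ordered_triples[OF inju, of "\<lambda>_. 1 :: real"] n_subsets[of ?T 3] by (simp add: case_prod_unfold)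
  have A0: "0 \<le> A" unfolding A_def by (intro sum_nonneg) (auto intro!: sum_nonneg)
  have A1: "A \<le> real n * ?C"
  proof -
    have "A \<le> (\<Sum>d\<in>?D. real n)"
      unfolding A_def
    proof (rule sum_mono)
      fix d assume "d \<in> ?D"
      have "(\<Sum>l\<in>?T. of_bool (P l)) \<le> real n" for P
        using sum_mono[of ?T "\<lambda>l. of_bool (P l)" "\<lambda>_. 1 :: real"] by simp
      then show "(case d of (a, b, c) \<Rightarrow> \<Sum>l\<in>?T. of_bool (u l * u b < u a)) \<le> real n"
        by (simp add: case_prod_unfold)
    qed
    then show ?thesis using cardD by (simp add: mult.commute)
  qed
  have C: "6 * ?C = real n * (real n - 1) * (real n - 2)"
    by (simp add: binomial_gbinomial gbinomial_prod_rev eval_nat_numeral)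
  have Cpos: "?C > 0" using n by simp
  have npos: "real n > 0" using n by simp
  have "I3 n x - (\<Sum>p\<in>{..<4} \<rightarrow>\<^sub>E ?T. I3_kernel (\<lambda>k\<in>{..<4}. u (p k))) / real n ^ 4
      = A / (real n * ?C) - 6 * A / real n ^ 4"
    unfolding I3 V using npos by (simp add: field_simps power2_eq_square power4_eq_xxxx)
  also have "\<dots> = A / (real n * ?C) * (1 - 6 * ?C / real n ^ 3)"
    using npos Cpos by (simp add: field_simps eval_nat_numeral)
  also have "1 - 6 * ?C / real n ^ 3 = (3 * real n - 2) / (real n)\<^sup>2"
    unfolding C using npos by (simp add: field_simps eval_nat_numeral)
  finally have diff: "I3 n x - (\<Sum>p\<in>{..<4} \<rightarrow>\<^sub>E ?T. I3_kernel (\<lambda>k\<in>{..<4}. u (p k))) / real n ^ 4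
      = A / (real n * ?C) * ((3 * real n - 2) / (real n)\<^sup>2)" .
  have "0 \<le> A / (real n * ?C)" "A / (real n * ?C) \<le> 1"
    using A0 A1 npos Cpos by (auto simp: divide_le_eq)
  moreover have "0 \<le> (3 * real n - 2) / (real n)\<^sup>2" "(3 * real n - 2) / (real n)\<^sup>2 \<le> 3 / real n"
    using n npos by (auto simp: field_simps power2_eq_square)
  moreover have "\<bar>q * w\<bar> \<le> s" if "0 \<le> q" "q \<le> 1" "0 \<le> w" "w \<le> s" for q w s :: real
    using mult_mono[of q 1 w s] that by simp
  ultimately show ?thesis unfolding diff by blast
qed

section \<open>Pareto variables\<close>

text \<open>
  The probability integral transform. The power function reverses the order, so the
  distribution function of the transform involves \<open>P(X < c)\<close> instead of \<open>P(X \<le> c)\<close>; they agree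
  because \<open>X\<close> has no atoms, its distribution function being continuous.
\<close>

lemma (in prob_space) distr_powr_pareto:
  fixes X :: "'a \<Rightarrow> real"
  assumes [measurable]: "X \<in> borel_measurable M" and lam: "lam > 0"
    and cdf: "\<And>x. x \<ge> 1 \<Longrightarrow> cdf (distr M borel X) x = 1 - x powr (- lam)"
  shows "AE \<omega> in M. X \<omega> > 1" and "distr M unif (\<lambda>\<omega>. X \<omega> powr (- lam)) = unif"
proof -
  interpret D: real_distribution "distr M borel X" by (rule real_distribution_distr) simp
  have le: "prob {\<omega> \<in> space M. X \<omega> \<le> x} = 1 - x powr (- lam)" if "x \<ge> 1" for x
    using cdf[OF that] by (simp add: cdf_def measure_distr vimage_def Int_def conj_commute)
  have "prob {\<omega> \<in> space M. X \<omega> \<le> 1} = 0" using le[of 1] by simp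
  then have "AE \<omega> in M. \<not> X \<omega> \<le> 1" by (subst (asm) prob_eq_0) auto
  then show gt: "AE \<omega> in M. X \<omega> > 1" by (simp add: not_le)
  have atom: "prob {\<omega> \<in> space M. X \<omega> = c} = 0" if c: "c > 1" for c
  proof -
    have "isCont (\<lambda>x. 1 - x powr (- lam)) c"
      using c by (auto intro!: continuous_intros)
    moreover have "\<forall>\<^sub>F x in nhds c. cdf (distr M borel X) x = 1 - x powr (- lam)"
      using eventually_nhds_in_open[of "{1<..}" c] c cdf by (auto elim: eventually_mono)
    ultimately have "isCont (cdf (distr M borel X)) c"
      by (simp add: isCont_cong)
    then have "measure (distr M borel X) {c} = 0" by (simp add: D.isCont_cdf)
    then show ?thesis by (simp add: measure_distr vimage_def Int_def conj_commute)
  qed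
  have unif_le: "prob {\<omega> \<in> space M. X \<omega> powr (- lam) \<le> s} = s" if s: "0 \<le> s" "s \<le> 1" for s
  proof -
    consider "s = 0" | "s = 1" | "0 < s" "s < 1" using s by linarith
    then show ?thesis
    proof cases
      case 1
      have "AE \<omega> in M. \<not> X \<omega> powr (- lam) \<le> 0" using gt by eventually_elim simp
      then show ?thesis unfolding 1 by (subst prob_eq_0) auto
    next
      case 2
      have "AE \<omega> in M. X \<omega> powr (- lam) \<le> 1"
        using gt
      proof eventually_elim
        case (elim \<omega>)
        then show ?case using powr_less_mono2_neg[of "- lam" 1 "X \<omega>"] lam by simp
      qed
      then show ?thesis unfolding 2 by (subst prob_Collect_eq_1) auto
    next
      case 3
      define c where "c = s powr (- 1 / lam)"
      have cs: "c powr (- lam) = s" using 3 lam by (simp add: c_def powr_powr)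
      have c: "c > 1"
        using powr_less_mono2_neg[of "- 1 / lam" s 1] 3 lam by (simp add: c_def)
      have "prob {\<omega> \<in> space M. X \<omega> powr (- lam) \<le> s} = prob {\<omega> \<in> space M. \<not> X \<omega> < c}"
      proof (rule prob_eq_AE)
        show "AE \<omega> in M. (X \<omega> powr (- lam) \<le> s) = (\<not> X \<omega> < c)"
          using gt
        proof eventually_elim
          case (elim \<omega>)
          then show ?case
            using powr_less_mono2_neg[of "- lam" "X \<omega>" c] powr_less_mono2_neg[of "- lam" c "X \<omega>"] c cs lam
            by (cases "X \<omega>" c rule: linorder_cases) auto
        qed
      qed auto
      also have "\<dots> = 1 - prob {\<omega> \<in> space M. X \<omega> < c}"
        by (rule prob_neg) auto
      also have "prob {\<omega> \<in> space M. X \<omega> < c} = prob {\<omega> \<in> space M. X \<omega> \<le> c}"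
      proof (rule prob_eq_AE)
        have "AE \<omega> in M. \<not> X \<omega> = c" using atom[OF c] by (subst (asm) prob_eq_0) auto
        then show "AE \<omega> in M. (X \<omega> < c) = (X \<omega> \<le> c)" by eventually_elim auto
      qed auto
      also have "\<dots> = 1 - s" using le[of c] c cs by simp
      finally show ?thesis by simp
    qed
  qed
  have "distributed M lborel (\<lambda>\<omega>. X \<omega> powr (- lam)) (\<lambda>x. indicator {0..1} x / measure lborel {0..1::real})"
    by (rule uniform_distrI_borel_atLeastAtMost) (auto simp: unif_le)
  then have "distr M lborel (\<lambda>\<omega>. X \<omega> powr (- lam)) = density lborel (\<lambda>x. ennreal (indicator {0..1} x))"
    by (simp add: distributed_def)
  also have "\<dots> = unif"
    unfolding unif_def
  proof (rule density_cong)
    show "AE x in lborel. ennreal (indicator {0..1::real} x) = indicator {0<..<1} x"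
      using AE_lborel_singleton[of 0] AE_lborel_singleton[of 1]
      by eventually_elim (auto simp: indicator_def)
  qed auto
  finally show "distr M unif (\<lambda>\<omega>. X \<omega> powr (- lam)) = unif"
    by (simp cong: distr_cong)
qed

lemma (in prob_space) AE_no_ties:
  assumes indep: "indep_vars (\<lambda>_. unif) U I" and law: "\<And>i. i \<in> I \<Longrightarrow> distr M unif (U i) = unif"
    and ij: "i \<in> I" "j \<in> I" "i \<noteq> j"
  shows "AE \<omega> in M. U i \<omega> \<noteq> U j \<omega>"
proof -
  have "indep_var (PiM {i} (\<lambda>_. unif)) (\<lambda>\<omega>. restrict (\<lambda>k. U k \<omega>) {i})
      (PiM {j} (\<lambda>_. unif)) (\<lambda>\<omega>. restrict (\<lambda>k. U k \<omega>) {j})"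
    using ij by (intro indep_var_restrict[OF indep]) auto
  from indep_var_compose[OF this, of "\<lambda>f. f i" unif "\<lambda>f. f j" unif]
  have "indep_var unif (U i) unif (U j)" by (simp add: comp_def)
  then have [measurable]: "U i \<in> M \<rightarrow>\<^sub>M unif" "U j \<in> M \<rightarrow>\<^sub>M unif"
    and joint: "distr M (unif \<Otimes>\<^sub>M unif) (\<lambda>\<omega>. (U i \<omega>, U j \<omega>)) = unif \<Otimes>\<^sub>M unif"
    using law ij by (auto simp: indep_var_distribution_eq)
  interpret uu: pair_prob_space unif unif ..
  have "AE p in unif \<Otimes>\<^sub>M unif. fst p \<noteq> snd p"
  proof (rule uu.AE_pair_measure)
    have "AE y in unif. x \<noteq> y" for x
      unfolding unif_def using AE_lborel_singleton[of x]
      by (subst AE_density) (auto elim!: eventually_mono)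
    then show "AE x in unif. AE y in unif. fst (x, y) \<noteq> snd (x, y)" by simp
  qed measurable
  then have "AE p in distr M (unif \<Otimes>\<^sub>M unif) (\<lambda>\<omega>. (U i \<omega>, U j \<omega>)). fst p \<noteq> snd p"
    unfolding joint .
  then have "AE \<omega> in M. fst (U i \<omega>, U j \<omega>) \<noteq> snd (U i \<omega>, U j \<omega>)"
    by (rule AE_distrD[rotated]) measurable
  then show ?thesis by simp
qed

lemma sort_3_nth:
  fixes a b c :: "'l :: linorder"
  shows "sort [a, b, c] ! 1 = max (min a b) (min (max a b) c)" "sort [a, b, c] ! 2 = max a (max b c)"
  by (auto simp: max_def min_def)

text \<open>
  Order statistics of three observations as lattice expressions, from which measurability in the
  observations can be read off.
\<close>

lemma order_stat_triple_eq:
  assumes "i < j" "j < k"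
  shows "order_stat 2 {i, j, k} x = max (min (x i) (x j)) (min (max (x i) (x j)) (x k))"
    "order_stat 3 {i, j, k} x = max (x i) (max (x j) (x k))"
proof -
  have "sorted_list_of_set {i, j, k} = [i, j, k]"
    using assms by (intro sorted_list_of_set.sorted_key_list_of_set_unique[THEN iffD1]) auto
  then show "order_stat 2 {i, j, k} x = max (min (x i) (x j)) (min (max (x i) (x j)) (x k))"
    "order_stat 3 {i, j, k} x = max (x i) (max (x j) (x k))"
    using sort_3_nth[of "x i" "x j" "x k"] by (simp_all add: order_stat_def del: sort_key_simps)
qed

lemma I3_measurable:
  assumes X: "\<And>i. i \<ge> 1 \<Longrightarrow> X i \<in> borel_measurable M" and n: "n \<ge> 1"
  shows "(\<lambda>\<omega>. I3 n (\<lambda>i. X i \<omega>)) \<in> borel_measurable M"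
proof -
  have ratio: "(\<lambda>\<omega>. ratio_df n (\<lambda>i. X i \<omega>) (X l \<omega>)) \<in> borel_measurable M" if l: "l \<ge> 1" for l
    unfolding ratio_df_def
  proof (intro borel_measurable_times borel_measurable_const borel_measurable_sum)
    fix d assume "d \<in> {(i1, i2, i3). 1 \<le> i1 \<and> i1 < i2 \<and> i2 < i3 \<and> i3 \<le> n}"
    then obtain i j k where d: "d = (i, j, k)" "1 \<le> i" "i < j" "j < k" by auto
    then have [measurable]: "X i \<in> borel_measurable M" "X j \<in> borel_measurable M" "X k \<in> borel_measurable M"
      "X l \<in> borel_measurable M"
      using X l by auto
    show "(\<lambda>\<omega>. case d of (i1, i2, i3) \<Rightarrow>
        of_bool (order_stat 3 {i1, i2, i3} (\<lambda>i. X i \<omega>) / order_stat 2 {i1, i2, i3} (\<lambda>i. X i \<omega>) < X l \<omega>))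
        \<in> borel_measurable M"
      unfolding d(1) prod.case order_stat_triple_eq[OF d(3,4)] by measurable
  qed
  have emp: "(\<lambda>\<omega>. emp_df n (\<lambda>i. X i \<omega>) (X l \<omega>)) \<in> borel_measurable M" if l: "l \<ge> 1" for l
    unfolding emp_df_def
  proof (intro borel_measurable_times borel_measurable_const borel_measurable_sum)
    fix i assume "i \<in> {1..n}"
    then have [measurable]: "X i \<in> borel_measurable M" "X l \<in> borel_measurable M" using X l by auto
    show "(\<lambda>\<omega>. of_bool (X i \<omega> < X l \<omega>)) \<in> borel_measurable M" by measurable
  qed
  have "I3 n (\<lambda>i. X i \<omega>) = inverse (real n) * (\<Sum>i = 1..n. indicator {1..} (X i \<omega>) *\<^sub>R
      (ratio_df n (\<lambda>i. X i \<omega>) (X i \<omega>) - emp_df n (\<lambda>i. X i \<omega>) (X i \<omega>)))" for \<omega>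
    unfolding I3_def set_lebesgue_integral_def by (rule integral_emp_measure) (use n in auto)
  moreover have "(\<lambda>\<omega>. inverse (real n) * (\<Sum>i = 1..n. indicator {1..} (X i \<omega>) *\<^sub>R
      (ratio_df n (\<lambda>i. X i \<omega>) (X i \<omega>) - emp_df n (\<lambda>i. X i \<omega>) (X i \<omega>)))) \<in> borel_measurable M"
    by (intro borel_measurable_times borel_measurable_const borel_measurable_sum borel_measurable_scaleR
        borel_measurable_diff ratio emp measurable_compose[OF X]) auto
  ultimately show ?thesis by simp
qed

section \<open>Asymptotic normality of the statistic\<close>

theorem theorem2:
  fixes M :: "'a measure"
    and X :: "nat \<Rightarrow> 'a \<Rightarrow> real"
    and lam :: real
  assumes "prob_space M"
    and "lam > 0"
    and "prob_space.indep_vars M (\<lambda>_. borel) X {1..}"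
    and "\<And>i x. i \<ge> 1 \<Longrightarrow> x \<ge> 1 \<Longrightarrow> cdf (distr M borel (X i)) x = 1 - x powr (- lam)"
  shows "weak_conv_m
           (\<lambda>n. distr M borel (\<lambda>\<omega>. sqrt (real n) * I3 n (\<lambda>i. X i \<omega>)))
           (density lborel (normal_density 0 (sqrt (11 / 120))))"
proof -
  interpret prob_space M by fact
  note lam = assms(2) and indep = assms(3) and cdf = assms(4)
  define U where "U i \<omega> = X i \<omega> powr (- lam)" for i \<omega>
  have X: "X i \<in> borel_measurable M" if "i \<ge> 1" for i
    using indep that by (auto simp: indep_vars_def)
  have gt: "AE \<omega> in M. X i \<omega> > 1" if "i \<ge> 1" for i
    using distr_powr_pareto(1)[OF X[OF that] lam cdf[OF that]] .
  have lawU: "distr M unif (U i) = unif" if "i \<in> {1..}" for i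
    using distr_powr_pareto(2)[OF X lam cdf, of i] that by (simp add: U_def[abs_def])
  have indepU: "indep_vars (\<lambda>_. unif) U {1..}"
    unfolding U_def[abs_def] by (rule indep_vars_compose2[OF indep]) measurable
  interpret K: iid_kernel M unif U 4 I3_kernel 7
  proof
    show "I3_kernel \<in> borel_measurable (PiM {..<4} (\<lambda>_. unif))"
      unfolding I3_kernel_def[abs_def] by measurable
    show "\<bar>I3_kernel y\<bar> \<le> 7" for y
      using kernel_bounds[of y] by (simp add: I3_kernel_def)
  qed (use indepU lawU in auto)
  have proj: "K.proj k t = (\<integral>y. I3_kernel (y(k := t)) \<partial>PiM ({..<4} - {k}) (\<lambda>_. unif))" for k t
    by (simp only: K.proj_def K.rest_def)
  have "K.mean = integral\<^sup>L unif (K.proj 3)" by (simp add: K.integral_proj)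
  also have "\<dots> = integral\<^sup>L unif (\<lambda>_. 0)"
    using K.proj_measurable[of 3]
    by (intro integral_unif_cong) (simp_all add: proj I3_kernel_proj_values measurable_def)
  finally have mean: "K.mean = 0" by simp
  have infl: "K.influence t = pareto_influence t" if t: "0 < t" "t < 1" for t
  proof -
    have "K.influence t = K.proj 0 t + K.proj 1 t + K.proj 2 t + K.proj 3 t"
      unfolding K.influence_def mean by (simp add: eval_nat_numeral)
    then show ?thesis
      unfolding proj I3_kernel_proj_values[OF t] pareto_influence_def by (simp add: algebra_simps power2_eq_square)
  qed
  have "\<bar>pareto_influence t\<bar> \<le> 56" if "0 < t" "t < 1" for t
    using K.influence_bounded[of t] infl[OF that] by simp
  note influence_sq = integral_pareto_influence_squared[OF this]
  have "(\<integral>t. (K.influence t)\<^sup>2 \<partial>unif) = (\<integral>t. (pareto_influence t)\<^sup>2 \<partial>unif)"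
  proof (rule integral_unif_cong)
    show "(\<lambda>t. (K.influence t)\<^sup>2) \<in> borel_measurable borel"
      using K.influence_measurable by (intro borel_measurable_power) (simp add: measurable_def)
    show "(\<lambda>t. (pareto_influence t)\<^sup>2) \<in> borel_measurable borel"
      unfolding pareto_influence_def by measurable
  qed (simp add: infl)
  then have var: "(\<integral>t. (K.influence t)\<^sup>2 \<partial>unif) = (sqrt (11 / 120))\<^sup>2"
    using influence_sq by simp
  \<comment> \<open>\<open>A\<close> is the V-statistic and \<open>B\<close> the statistic of the theorem, both at scale \<open>sqrt n\<close>.\<close>
  define A where "A n \<omega> = sqrt (real n) * (K.vsum n \<omega> / real n ^ 4)" for n \<omega>
  define B where "B n \<omega> = sqrt (real n) * I3 n (\<lambda>i. X i \<omega>)" for n \<omega>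
  have convA: "weak_conv_m (\<lambda>n. distr M borel (A n)) (density lborel (normal_density 0 (sqrt (11 / 120))))"
    using K.vstatistic_clt[OF _ var] by (simp add: mean A_def[abs_def])
  have mA[measurable]: "A n \<in> borel_measurable M" for n
    unfolding A_def[abs_def] by measurable
  have mB[measurable]: "B n \<in> borel_measurable M" for n
  proof (cases "n = 0")
    case False
    then show ?thesis
      unfolding B_def[abs_def] using I3_measurable[of X M n] X by simp
  qed (simp add: B_def[abs_def])
  have gt_all: "AE \<omega> in M. \<forall>i. i \<ge> 1 \<longrightarrow> X i \<omega> > 1"
    unfolding AE_all_countable using gt by auto
  have no_ties: "AE \<omega> in M. \<forall>i j. i \<ge> 1 \<longrightarrow> j \<ge> 1 \<longrightarrow> i \<noteq> j \<longrightarrow> U i \<omega> \<noteq> U j \<omega>"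
    unfolding AE_all_countable using AE_no_ties[OF indepU lawU] by auto
  have close: "AE \<omega> in M. \<bar>A n \<omega> - B n \<omega>\<bar> \<le> 3 / sqrt n" if n: "n \<ge> 3" for n
    using gt_all no_ties
  proof eventually_elim
    case (elim \<omega>)
    have "inj_on (\<lambda>i. X i \<omega>) {1..n}"
    proof (rule inj_onI, rule ccontr)
      fix i j assume ij: "i \<in> {1..n}" "j \<in> {1..n}" "X i \<omega> = X j \<omega>" "i \<noteq> j"
      then have "U i \<omega> \<noteq> U j \<omega>" using elim(2) by simp
      then show False using ij by (simp add: U_def)
    qed
    then have "\<bar>I3 n (\<lambda>i. X i \<omega>) - K.vsum n \<omega> / real n ^ 4\<bar> \<le> 3 / n"
      unfolding K.vsum_def K.tuples_def K.h_at_def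
      using elim by (intro I3_close_to_vstatistic[OF n lam]) (auto simp: U_def)
    then have "sqrt n * \<bar>I3 n (\<lambda>i. X i \<omega>) - K.vsum n \<omega> / real n ^ 4\<bar> \<le> sqrt n * (3 / n)"
      by (rule mult_left_mono) simp
    moreover have "\<bar>A n \<omega> - B n \<omega>\<bar> = sqrt n * \<bar>I3 n (\<lambda>i. X i \<omega>) - K.vsum n \<omega> / real n ^ 4\<bar>"
      unfolding A_def B_def right_diff_distrib[symmetric] abs_mult by (simp add: abs_minus_commute)
    moreover have "sqrt n * (3 / n) = 3 / sqrt n"
      using n by (simp add: field_simps)
    ultimately show ?case by simp
  qed
  have int: "integrable M (\<lambda>\<omega>. A n \<omega> - B n \<omega>)" if "n \<ge> 3" for n
    by (rule integrable_const_bound[of _ "3 / sqrt n"]) (use close[OF that] in auto)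
  have L1: "expectation (\<lambda>\<omega>. \<bar>A n \<omega> - B n \<omega>\<bar>) \<le> 3 / sqrt n" if "n \<ge> 3" for n
  proof -
    have "expectation (\<lambda>\<omega>. \<bar>A n \<omega> - B n \<omega>\<bar>) \<le> expectation (\<lambda>\<omega>. 3 / sqrt n)"
      using int[OF that] close[OF that] by (intro integral_mono_AE) auto
    then show ?thesis by (simp add: prob_space)
  qed
  have "weak_conv_m (\<lambda>n. distr M borel (B n)) (density lborel (normal_density 0 (sqrt (11 / 120))))"
  proof (rule weak_conv_m_L1_close[OF mA mB _ convA])
    show "real_distribution (density lborel (normal_density 0 (sqrt (11 / 120))))"
      using prob_space_normal_density[of "sqrt (11 / 120)" 0]
      by (auto simp: real_distribution_def real_distribution_axioms_def)
    show "\<forall>\<^sub>F n in sequentially. integrable M (\<lambda>\<omega>. A n \<omega> - B n \<omega>)"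
      using int by (rule eventually_sequentiallyI)
    have "(\<lambda>n. 3 / sqrt (real n)) \<longlonglongrightarrow> 0" by real_asymp
    then show "(\<lambda>n. expectation (\<lambda>\<omega>. \<bar>A n \<omega> - B n \<omega>\<bar>)) \<longlonglongrightarrow> 0"
      by (rule tendsto_sandwich[OF _ _ tendsto_const, rotated 2])
         (auto intro!: eventually_sequentiallyI[of 3] L1)
  qed
  then show ?thesis unfolding B_def[abs_def] .
qed

end
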